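(* Let $d\ge 3$ and $1\le i\le d-2$ be integers, let $K_d$ be a complete metric graph on $d$ vertices (with arbitrary edge lengths), let $e_1,\dots,e_i$ be distinct edges of $K_d$, and let $K_d'=K_d\setminus\{e_1,\dots,e_i\}$ be the metric graph obtained by omitting these edges. Then, for every integer $h\ge 1$, the gonality of $K_d'$ is $d-h$ if and only if the set of omitted edges $\{e_1,\dots,e_i\}$ contains a $K_h$ configuration but not a $K_{h+1}$ configuration.
   Context: A metric graph $\Gamma$ is a compact connected topological space in which every point $p$ has a neighbourhood homeomorphic to a star with $\mathrm{val}(p)$ branches (with $\mathrm{val}(p)\neq 2$ for only finitely many $p$), equipped with a complete inner metric. The complete metric graph $K_d$ on $d$ vertices is the metric realization of the complete graph on $d$ vertices, where the edges have arbitrary (positive, finite) lengths. Omitting an edge means removing its interior; all $d$ vertices are kept. (With at most $d-2$ edges omitted, the resulting graph is connected.) A set of edges contains a $K_h$ configuration if there are $h$ vertices of $K_d$ such that all $\binom{h}{2}$ edges between them belong to the set. A divisor on $\Gamma$ is an element $D=\sum_{p} a_p(p)$ of the free abelian group on the points of $\Gamma$; its degree is $\sum_p a_p$; it is effective ($D\geq 0$) if all $a_p\ge 0$. A rational function on $\Gamma$ is a continuous piecewise linear function $f:\Gamma\to\mathbb{R}$ with integer slopes and finitely many pieces; $\mathrm{div}(f)$ is the divisor whose coefficient at $p$ is the sum of the outgoing slopes of $f$ at $p$. Divisors $D_1,D_2$ are linearly equivalent, $D_1\sim D_2$, if $D_1-D_2=\mathrm{div}(f)$ for some rational function $f$, and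 $|D|=\{E\ge 0: E\sim D\}$. The rank $\mathrm{rk}_\Gamma(D)$ is $-1$ if $|D|=\emptyset$, and otherwise the maximal integer $r\ge 0$ such that $|D-E|\ne\emptyset$ for all effective divisors $E$ of degree $r$. The gonality $\mathrm{gon}(\Gamma)$ is the smallest integer $n$ for which there is a divisor on $\Gamma$ of degree $n$ and rank $1$. *)

theory Defs
  imports "HOL-Analysis.Analysis" "HOL-Library.Poly_Mapping" "HOL-Library.Ramsey"
begin

section \<open>Metric realizations of weighted graphs\<close>

text \<open>A finite simple graph whose edges are two-element sets of vertices, with an edge length
  function. The values of the length function outside the edge set are irrelevant.\<close>

record 'a wgraph =
  verts :: "'a set"
  edges :: "'a set set"
  len :: "'a set \<Rightarrow> real"

definition complete_wgraph :: "'a set \<Rightarrow> ('a set \<Rightarrow> real) \<Rightarrow> 'a wgraph" where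
  "complete_wgraph V l = \<lparr>verts = V, edges = [V]\<^bsup>2\<^esup>, len = l\<rparr>"

definition omit_edges :: "'a wgraph \<Rightarrow> 'a set set \<Rightarrow> 'a wgraph" where
  "omit_edges G F = G\<lparr>edges := edges G - F\<rparr>"

text \<open>The realization is modelled by barycentric coordinates: the vertex \<open>v\<close> is the indicator
  function of \<open>{v}\<close>, and \<open>edge_point G u v t\<close>, for \<open>0 \<le> t \<le> len G {u, v}\<close>, is the point of the
  edge \<open>{u, v}\<close> at distance \<open>t\<close> from \<open>u\<close> along that edge. So \<open>t\<close> is an arc length parameter
  (the metric enters only through it), the value \<open>t = 0\<close> gives the vertex \<open>u\<close>, the value
  \<open>t = len G {u, v}\<close> gives the vertex \<open>v\<close>, and exchanging \<open>u\<close> and \<open>v\<close> reverses the edge.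
  For a finite vertex set, the topology of pointwise convergence on the realization is the
  usual topology (the one of the inner metric with these edge lengths).\<close>

type_synonym 'a point = "'a \<Rightarrow> real"

definition vertex_point :: "'a \<Rightarrow> 'a point" where
  "vertex_point v = (\<lambda>w. if w = v then 1 else 0)"

definition edge_point :: "'a wgraph \<Rightarrow> 'a \<Rightarrow> 'a \<Rightarrow> real \<Rightarrow> 'a point" where
  "edge_point G u v t =
    (\<lambda>w. if w = u then 1 - t / len G {u, v} else if w = v then t / len G {u, v} else 0)"

definition points :: "'a wgraph \<Rightarrow> 'a point set" where
  "points G = vertex_point ` verts G \<union>
    {edge_point G u v t | u v t. {u, v} \<in> edges G \<and> 0 \<le> t \<and> t \<le> len G {u, v}}"

section \<open>Rational functions\<close>

definition pl_int_slopes :: "real \<Rightarrow> real \<Rightarrow> (real \<Rightarrow> real) \<Rightarrow> bool" where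
  "pl_int_slopes a b g \<longleftrightarrow>
    (\<exists>B. finite B \<and>
      (\<forall>x y. a \<le> x \<and> x < y \<and> y \<le> b \<and> {x<..<y} \<inter> B = {} \<longrightarrow>
        (\<exists>m::int. \<forall>t\<in>{x..y}. g t = g x + of_int m * (t - x))))"

definition rational_function :: "'a wgraph \<Rightarrow> ('a point \<Rightarrow> real) \<Rightarrow> bool" where
  "rational_function G f \<longleftrightarrow>
    continuous_on (points G) f \<and>
    (\<forall>u v. {u, v} \<in> edges G \<longrightarrow> pl_int_slopes 0 (len G {u, v}) (\<lambda>t. f (edge_point G u v t)))"

text \<open>The branches at a point \<open>p\<close>. A triple \<open>(u, v, t)\<close> is the direction from the point at
  distance \<open>t\<close> from \<open>u\<close> on the edge \<open>{u, v}\<close> towards \<open>v\<close>. Each pair \<open>u, v\<close> occurs in both orders,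
  so a vertex \<open>u\<close> has the one branch \<open>(u, v, 0)\<close> for each neighbour \<open>v\<close>, and an interior point
  of the edge \<open>{u, v}\<close> has the two branches \<open>(u, v, t)\<close> and \<open>(v, u, len G {u, v} - t)\<close>.\<close>

definition branches :: "'a wgraph \<Rightarrow> 'a point \<Rightarrow> ('a \<times> 'a \<times> real) set" where
  "branches G p =
    {(u, v, t). {u, v} \<in> edges G \<and> 0 \<le> t \<and> t < len G {u, v} \<and> edge_point G u v t = p}"

definition outgoing_slope :: "'a wgraph \<Rightarrow> ('a point \<Rightarrow> real) \<Rightarrow> 'a \<times> 'a \<times> real \<Rightarrow> int" where
  "outgoing_slope G f = (\<lambda>(u, v, t).
    THE m::int. ((\<lambda>s. f (edge_point G u v s)) has_real_derivative of_int m) (at_right t))"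

definition div_of :: "'a wgraph \<Rightarrow> ('a point \<Rightarrow> real) \<Rightarrow> 'a point \<Rightarrow> int" where
  "div_of G f p = (\<Sum>b\<in>branches G p. outgoing_slope G f b)"

section \<open>Divisors, rank and gonality\<close>

definition divisor_on :: "'a wgraph \<Rightarrow> ('a point \<Rightarrow>\<^sub>0 int) \<Rightarrow> bool" where
  "divisor_on G D \<longleftrightarrow> Poly_Mapping.keys D \<subseteq> points G"

definition div_degree :: "('a point \<Rightarrow>\<^sub>0 int) \<Rightarrow> int" where
  "div_degree D = (\<Sum>p\<in>Poly_Mapping.keys D. Poly_Mapping.lookup D p)"

definition effective :: "('a point \<Rightarrow>\<^sub>0 int) \<Rightarrow> bool" where
  "effective D \<longleftrightarrow> (\<forall>p. 0 \<le> Poly_Mapping.lookup D p)"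

definition lin_equiv :: "'a wgraph \<Rightarrow> ('a point \<Rightarrow>\<^sub>0 int) \<Rightarrow> ('a point \<Rightarrow>\<^sub>0 int) \<Rightarrow> bool" where
  "lin_equiv G D1 D2 \<longleftrightarrow>
    (\<exists>f. rational_function G f \<and> Poly_Mapping.lookup (D1 - D2) = div_of G f)"

definition linear_system :: "'a wgraph \<Rightarrow> ('a point \<Rightarrow>\<^sub>0 int) \<Rightarrow> ('a point \<Rightarrow>\<^sub>0 int) set" where
  "linear_system G D = {E. divisor_on G E \<and> effective E \<and> lin_equiv G E D}"

definition div_rank :: "'a wgraph \<Rightarrow> ('a point \<Rightarrow>\<^sub>0 int) \<Rightarrow> int" where
  "div_rank G D =
    (if linear_system G D = {} then - 1
     else int (GREATEST r. \<forall>E. divisor_on G E \<and> effective E \<and> div_degree E = int r \<longrightarrow>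
                 linear_system G (D - E) \<noteq> {}))"

definition gonality :: "'a wgraph \<Rightarrow> int" where
  "gonality G = (LEAST n. \<exists>D. divisor_on G D \<and> div_degree D = n \<and> div_rank G D = 1)"

section \<open>Clique configurations in a set of edges\<close>

definition contains_K :: "'a set \<Rightarrow> 'a set set \<Rightarrow> nat \<Rightarrow> bool" where
  "contains_K V F h \<longleftrightarrow> (\<exists>S\<subseteq>V. card S = h \<and> [S]\<^bsup>2\<^esup> \<subseteq> F)"

section \<open>Consistency checks\<close>

lemma edge_point_ends:
  assumes "u \<noteq> v" "0 < len G {u, v}"
  shows "edge_point G u v 0 = vertex_point u"
    and "edge_point G u v (len G {u, v}) = vertex_point v"
  using assms by (auto simp: edge_point_def vertex_point_def)

lemma edge_point_reverse:
  assumes "u \<noteq> v" "0 < len G {u, v}"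
  shows "edge_point G v u (len G {u, v} - t) = edge_point G u v t"
  using assms by (auto simp: edge_point_def insert_commute diff_divide_distrib)

lemma outgoing_slope_eqI:
  assumes "((\<lambda>s. f (edge_point G u v s)) has_real_derivative of_int m) (at_right t)"
  shows "outgoing_slope G f (u, v, t) = m"
  unfolding outgoing_slope_def prod.case
proof (rule the_equality)
  fix k :: int
  assume k: "((\<lambda>s. f (edge_point G u v s)) has_real_derivative of_int k) (at_right t)"
  have "at_right t \<noteq> bot"
    by (rule trivial_limit_at_right_real)
  then have "real_of_int k = real_of_int m"
    using k[unfolded has_real_derivative_iff_has_vector_derivative]
      assms[unfolded has_real_derivative_iff_has_vector_derivative]
    by (rule vector_derivative_unique_within)
  then show "k = m"
    by (simp only: of_int_eq_iff)
qed (rule assms)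

text \<open>Omitting edges from the weighted graph removes exactly the interiors of these edges.\<close>

lemma edge_point_in_interior:
  assumes "u \<noteq> v" "0 < t" "t < len G {u, v}"
  shows "{w. edge_point G u v t w \<noteq> 0} = {u, v}"
  using assms by (auto simp: edge_point_def)

lemma points_omit_edges:
  assumes "edges G \<subseteq> [verts G]\<^bsup>2\<^esup>" "\<And>e. e \<in> edges G \<Longrightarrow> 0 < len G e" "F \<subseteq> edges G"
  shows "points (omit_edges G F) = points G -
    {edge_point G u v t | u v t. {u, v} \<in> F \<and> 0 < t \<and> t < len G {u, v}}"
proof -
  define I where "I = {edge_point G u v t | u v t. {u, v} \<in> F \<and> 0 < t \<and> t < len G {u, v}}"
  have ne: "u \<noteq> v \<and> 0 < len G {u, v} \<and> u \<in> verts G \<and> v \<in> verts G" if "{u, v} \<in> edges G" for u v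
    using subsetD[OF assms(1) that] assms(2)[OF that] by simp
  have ends: "edge_point G u v t \<in> vertex_point ` verts G"
    if "{u, v} \<in> edges G" "t = 0 \<or> t = len G {u, v}" for u v t
    using that(2) ne[OF that(1)] edge_point_ends[of u v G] by auto
  have interior: "{w. p w \<noteq> 0} \<in> F" if "p \<in> I" for p
  proof -
    from that obtain u v t where *: "p = edge_point G u v t" "{u, v} \<in> F" "0 < t" "t < len G {u, v}"
      unfolding I_def by blast
    have "u \<noteq> v" using ne[OF subsetD[OF assms(3) *(2)]] by simp
    from edge_point_in_interior[OF this *(3,4)] *(1,2) show ?thesis by simp
  qed
  have vert: "p \<notin> I" if "p \<in> vertex_point ` verts G" for p
  proof
    from that obtain v where v: "p = vertex_point v" by blast
    assume "p \<in> I"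
    moreover have "{w. p w \<noteq> 0} = {v}"
      by (auto simp: v vertex_point_def)
    ultimately have "{v} \<in> F"
      using interior[of p] by simp
    then have "{v} \<in> [verts G]\<^bsup>2\<^esup>"
      using assms(1,3) by blast
    then show False
      by (simp add: nsets_def)
  qed
  have ep: "edge_point (omit_edges G F) = edge_point G"
    by (simp add: edge_point_def omit_edges_def fun_eq_iff)
  have pts: "points (omit_edges G F) = vertex_point ` verts G \<union>
    {edge_point G u v t | u v t. {u, v} \<in> edges G - F \<and> 0 \<le> t \<and> t \<le> len G {u, v}}"
    unfolding points_def ep by (simp add: omit_edges_def)
  have sub: "p \<in> points G - I" if "p \<in> points (omit_edges G F)" for p
  proof (cases "p \<in> vertex_point ` verts G")
    case True
    then show ?thesis using vert by (simp add: points_def)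
  next
    case False
    with that obtain u v t where E: "p = edge_point G u v t" "{u, v} \<in> edges G" "{u, v} \<notin> F"
        "0 \<le> t" "t \<le> len G {u, v}"
      unfolding pts by blast
    have "\<not> (t = 0 \<or> t = len G {u, v})"
      using ends[OF E(2), of t] False E(1) by blast
    then have "{w. p w \<noteq> 0} = {u, v}"
      using E edge_point_in_interior[of u v t G] ne[OF E(2)] by simp
    then have "p \<notin> I"
      using interior[of p] E(3) by auto
    moreover have "p \<in> points G"
      unfolding points_def using E by blast
    ultimately show ?thesis by simp
  qed
  have sup: "p \<in> points (omit_edges G F)" if "p \<in> points G" "p \<notin> I" for p
  proof (cases "p \<in> vertex_point ` verts G")
    case True
    then show ?thesis by (simp add: pts)
  next
    case False
    with that(1) obtain u v t where E: "p = edge_point G u v t" "{u, v} \<in> edges G"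
        "0 \<le> t" "t \<le> len G {u, v}"
      unfolding points_def by blast
    have "\<not> (t = 0 \<or> t = len G {u, v})"
      using ends[OF E(2), of t] False E(1) by blast
    then have "0 < t" "t < len G {u, v}" using E by auto
    with that(2) E have "{u, v} \<notin> F"
      unfolding I_def by blast
    with E show ?thesis unfolding pts by blast
  qed
  show ?thesis using sub sup unfolding I_def[symmetric] by blast
qed

end

theory Submission
  imports Defs
begin

text \<open>Write \<open>\<omega>\<close> for the largest \<open>h\<close> such that the omitted edges contain a \<open>K\<^sub>h\<close> configuration. A set of
  vertices spans such a configuration iff it is independent in the remaining graph, and containing a
  configuration is inherited by smaller sizes, so the theorem says that the gonality is \<open>d - \<omega>\<close>. The
  gonality is the least degree of a divisor \<open>D\<close> of positive rank, that is, one for which \<open>|D - p|\<close> is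
  nonempty for every point \<open>p\<close>: a divisor of rank at least 2 is not of least degree, since one may
  subtract a point from it.

  Upper bound. If \<open>S\<close> is independent with \<open>\<omega>\<close> elements, put one chip on every vertex outside \<open>S\<close>. All
  neighbours of \<open>x \<in> S\<close> carry a chip, and these chips can travel simultaneously towards \<open>x\<close>
  (lemma \<open>move_chips_towards\<close>) until the first of them arrives; two chips on one closed edge can be
  moved towards each other (lemma \<open>reaches_between\<close>). These moves reach every point, which is
  \<open>ex_divisor_of_independent_set\<close>.

  Lower bound. Let \<open>D\<close> have positive rank and degree \<open>n \<le> d - 3\<close> (for \<open>n \<ge> d - 2\<close> it is enough that
  \<open>\<omega> \<ge> 2\<close>). If \<open>f\<close> satisfies \<open>D + div f \<ge> 0\<close> with \<open>D\<close> effective, cutting \<open>f\<close> off at a level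
  \<open>c\<close> shows that at most \<open>n\<close> edges join a vertex where \<open>f < c\<close> to a vertex where \<open>f > c\<close>
  (lemma \<open>card_cut_le_degree\<close>). At most \<open>d - 2\<close> edges are omitted, so a cut with at least two vertices
  on both sides has at least \<open>d - 2 > n\<close> edges, and some vertex \<open>v\<^sub>0\<close> lies on at most one omitted edge,
  so that the cut around \<open>v\<^sub>0\<close> has at least \<open>d - 2\<close> edges, too. Replace \<open>D\<close> by the equivalent
  \<open>v\<^sub>0\<close>-reduced divisor (lemma \<open>reduced_divisor_exists\<close>), for which every \<open>f\<close> as above is maximal at
  \<open>v\<^sub>0\<close>. Let \<open>x\<close> be a vertex without a chip, and let \<open>f\<close> move a chip to \<open>x\<close>; cut \<open>f\<close> off below at
  \<open>f x\<close>. The only cuts left are those around \<open>x\<close>, so \<open>f\<close> attains its maximum at all vertices other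
  than \<open>x\<close>. On every edge from \<open>x\<close> to a vertex \<open>w\<close> the function \<open>f\<close> leaves its maximum before
  reaching \<open>x\<close>, and where it does so \<open>D\<close> has a chip: at \<open>w\<close> or in the interior of the edge.
  Consequently, if \<open>S\<close> is the set of vertices without a chip, then \<open>n\<close> is at least \<open>d - |S|\<close> plus the
  number of edges inside \<open>S\<close>. Deleting from \<open>S\<close> one end of each of these edges leaves an independent
  set with at least \<open>d - n\<close> elements (lemma \<open>independent_set_of_low_degree\<close>), whence \<open>d - n \<le> \<omega>\<close>.

  The reduced divisor is obtained without a compactness argument: the pointwise supremum \<open>F\<close> of all
  \<open>f\<close> with \<open>D + div f \<ge> 0\<close> and \<open>f v\<^sub>0 = 0\<close> is again such a function. Away from the chips of \<open>D\<close> these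
  functions are convex along edges, with integer slopes bounded by \<open>n\<close>, so their supremum is a maximum
  of finitely many affine functions.\<close>


section \<open>One-sided slopes of piecewise linear functions\<close>

text \<open>\<open>rgerm \<phi> t m\<close>: immediately to the right of \<open>t\<close> the function \<open>\<phi>\<close> is affine with slope \<open>m\<close>.
  Slopes to the left are expressed by the same notion for the reversed function \<open>\<lambda>s. \<phi> (L - s)\<close> at
  \<open>L - t\<close>; they are then outgoing slopes, just as the slopes to the right.\<close>

definition rgerm :: "(real \<Rightarrow> real) \<Rightarrow> real \<Rightarrow> int \<Rightarrow> bool" where
  "rgerm \<phi> t m \<longleftrightarrow> (\<forall>\<^sub>F s in at_right 0. \<phi> (t + s) = \<phi> t + of_int m * s)"

lemma rgermE:
  assumes "rgerm \<phi> t m"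
  obtains e where "0 < e" "\<And>s. 0 \<le> s \<Longrightarrow> s \<le> e \<Longrightarrow> \<phi> (t + s) = \<phi> t + of_int m * s"
proof -
  obtain b where b: "0 < b" "\<And>s. 0 < s \<Longrightarrow> s < b \<Longrightarrow> \<phi> (t + s) = \<phi> t + of_int m * s"
    using assms unfolding rgerm_def eventually_at_right_field by auto
  show thesis
  proof (rule that)
    show "0 < b / 2" using b(1) by simp
    fix s :: real assume s: "0 \<le> s" "s \<le> b / 2"
    show "\<phi> (t + s) = \<phi> t + of_int m * s"
    proof (cases "s = 0")
      case False
      with s b(1) show ?thesis by (intro b(2)) auto
    qed simp
  qed
qed

lemma rgermI:
  assumes "0 < e" "\<And>s. 0 < s \<Longrightarrow> s < e \<Longrightarrow> \<phi> (t + s) = \<phi> t + of_int m * s"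
  shows "rgerm \<phi> t m"
  unfolding rgerm_def eventually_at_right_field using assms by auto

lemma rgerm_unique:
  assumes "rgerm \<phi> t m" "rgerm \<phi> t k"
  shows "m = k"
proof -
  obtain e where e: "0 < e" "\<And>s. 0 \<le> s \<Longrightarrow> s \<le> e \<Longrightarrow> \<phi> (t + s) = \<phi> t + of_int m * s"
    using assms(1) by (rule rgermE) blast
  obtain d where d: "0 < d" "\<And>s. 0 \<le> s \<Longrightarrow> s \<le> d \<Longrightarrow> \<phi> (t + s) = \<phi> t + of_int k * s"
    using assms(2) by (rule rgermE) blast
  define s where "s = min e d"
  have "0 < s" "s \<le> e" "s \<le> d" using e d by (auto simp: s_def)
  then have "of_int m * s = of_int k * s" using e(2)[of s] d(2)[of s] by simp
  with \<open>0 < s\<close> show ?thesis by simp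
qed

lemma rgerm_has_derivative:
  assumes "rgerm \<phi> t m"
  shows "(\<phi> has_real_derivative of_int m) (at_right t)"
proof -
  obtain e where e: "0 < e" "\<And>s. 0 \<le> s \<Longrightarrow> s \<le> e \<Longrightarrow> \<phi> (t + s) = \<phi> t + of_int m * s"
    using assms by (rule rgermE) blast
  have "\<forall>\<^sub>F s in at_right t. (\<phi> s - \<phi> t) / (s - t) = of_int m"
    unfolding eventually_at_right_field
  proof (intro exI[of _ "t + e"] conjI allI impI)
    fix s assume s: "t < s" "s < t + e"
    then show "(\<phi> s - \<phi> t) / (s - t) = of_int m"
      using e(2)[of "s - t"] by (simp add: field_simps)
  qed (use e(1) in auto)
  then show ?thesis
    unfolding has_field_derivative_iff by (rule tendsto_eventually)
qed

lemma rgerm_cong: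
  assumes "rgerm \<phi> t m" "0 < e" "\<And>s. 0 \<le> s \<Longrightarrow> s < e \<Longrightarrow> \<psi> (t + s) = \<phi> (t + s)"
  shows "rgerm \<psi> t m"
proof -
  obtain d where d: "0 < d" "\<And>s. 0 \<le> s \<Longrightarrow> s \<le> d \<Longrightarrow> \<phi> (t + s) = \<phi> t + of_int m * s"
    using assms(1) by (rule rgermE) blast
  show ?thesis
    by (rule rgermI[where e = "min e d"]) (use assms(2) d assms(3)[of 0] assms(3) in auto)
qed

lemma rgerm_add:
  assumes "rgerm \<phi> t m" "rgerm \<psi> t k"
  shows "rgerm (\<lambda>s. \<phi> s + \<psi> s) t (m + k)"
  using assms unfolding rgerm_def by eventually_elim (simp add: algebra_simps)

lemma rgerm_uminus: "rgerm \<phi> t m \<Longrightarrow> rgerm (\<lambda>s. - \<phi> s) t (- m)"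
  unfolding rgerm_def by (erule eventually_mono) (simp add: algebra_simps)

lemma rgerm_diff:
  assumes "rgerm \<phi> t m" "rgerm \<psi> t k"
  shows "rgerm (\<lambda>s. \<phi> s - \<psi> s) t (m - k)"
  using rgerm_add[OF assms(1) rgerm_uminus[OF assms(2)]] by simp

lemma rgerm_mult: "rgerm \<phi> t m \<Longrightarrow> rgerm (\<lambda>s. of_int c * \<phi> s) t (c * m)"
  unfolding rgerm_def by (erule eventually_mono) (simp add: algebra_simps)

lemma rgerm_affine: "rgerm (\<lambda>s. c + of_int m * s) t m"
  by (rule rgermI[of 1]) (auto simp: algebra_simps)

lemma rgerm_const: "rgerm (\<lambda>s. c) t 0"
  using rgerm_affine[of c 0 t] by simp

lemma rgerm_sum:
  assumes "finite A" "\<And>a. a \<in> A \<Longrightarrow> rgerm (\<phi> a) t (m a)"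
  shows "rgerm (\<lambda>s. \<Sum>a\<in>A. \<phi> a s) t (\<Sum>a\<in>A. m a)"
  using assms by (induction A) (auto intro: rgerm_add rgerm_const)

lemma rgerm_tendsto:
  assumes "rgerm \<phi> t m"
  shows "((\<lambda>s. \<phi> (t + s)) \<longlongrightarrow> \<phi> t) (at_right 0)"
proof -
  have "((\<lambda>s. \<phi> t + of_int m * s) \<longlongrightarrow> \<phi> t + of_int m * 0) (at_right 0)"
    by (intro tendsto_intros)
  then show ?thesis
    using assms unfolding rgerm_def
    by (subst filterlim_cong[OF refl refl]) auto
qed

lemma rgerm_max:
  assumes "rgerm \<phi> t m" "rgerm \<psi> t k"
  shows "rgerm (\<lambda>s. max (\<phi> s) (\<psi> s)) t
    (if \<phi> t > \<psi> t then m else if \<phi> t < \<psi> t then k else max m k)"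
proof -
  have *: "((\<lambda>s. \<phi> (t + s) - \<psi> (t + s)) \<longlongrightarrow> \<phi> t - \<psi> t) (at_right 0)"
    by (intro tendsto_intros rgerm_tendsto[OF assms(1)] rgerm_tendsto[OF assms(2)])
  consider "\<phi> t > \<psi> t" | "\<phi> t < \<psi> t" | "\<phi> t = \<psi> t" by linarith
  then show ?thesis
  proof cases
    case 1
    then have "\<forall>\<^sub>F s in at_right 0. \<phi> (t + s) - \<psi> (t + s) > 0"
      using order_tendstoD(1)[OF *, of 0] by simp
    with assms(1) 1 show ?thesis unfolding rgerm_def
      by (auto elim: eventually_elim2)
  next
    case 2
    then have "\<forall>\<^sub>F s in at_right 0. \<phi> (t + s) - \<psi> (t + s) < 0"
      using order_tendstoD(2)[OF *, of 0] by simp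
    with assms(2) 2 show ?thesis unfolding rgerm_def
      by (auto elim: eventually_elim2)
  next
    case 3
    have pos: "\<forall>\<^sub>F s in at_right 0. s > (0::real)"
      by (simp add: eventually_at_right_less)
    have "\<forall>\<^sub>F s in at_right 0. max (\<phi> (t + s)) (\<psi> (t + s)) = \<phi> t + of_int (max m k) * s"
      using assms[unfolded rgerm_def] pos
    proof eventually_elim
      case (elim s)
      have "max (of_int m * s) (of_int k * s) = of_int (max m k) * s"
        using elim(3) by (auto simp: max_def)
      with elim(1,2) 3 show ?case by (simp add: max_def split: if_splits)
    qed
    with 3 show ?thesis unfolding rgerm_def by simp
  qed
qed

lemma rgerm_bound_below:
  assumes "rgerm \<phi> t m" "0 < e" "\<And>s. 0 < s \<Longrightarrow> s < e \<Longrightarrow> \<phi> t + of_int k * s \<le> \<phi> (t + s)"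
  shows "k \<le> m"
proof -
  obtain d where d: "0 < d" "\<And>s. 0 \<le> s \<Longrightarrow> s \<le> d \<Longrightarrow> \<phi> (t + s) = \<phi> t + of_int m * s"
    using assms(1) by (rule rgermE) blast
  define s where "s = min d (e / 2)"
  have s: "0 < s" "s \<le> d" "s < e" using d(1) assms(2) by (auto simp: s_def)
  then have "of_int k * s \<le> of_int m * s" using d(2)[of s] assms(3)[of s] by simp
  with s(1) show ?thesis by simp
qed

lemma rgerm_bound_above:
  assumes "rgerm \<phi> t m" "0 < e" "\<And>s. 0 < s \<Longrightarrow> s < e \<Longrightarrow> \<phi> (t + s) \<le> \<phi> t + of_int k * s"
  shows "m \<le> k"
proof -
  have "- k \<le> - m"
    using rgerm_uminus[OF assms(1)] assms(2)
  proof (rule rgerm_bound_below)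
    fix s assume "0 < s" "s < e"
    from assms(3)[OF this] show "- \<phi> t + of_int (- k) * s \<le> - \<phi> (t + s)" by simp
  qed
  then show ?thesis by simp
qed

lemma rgerm_linear:
  assumes "x \<le> t" "t < y" "\<And>s. s \<in> {x..y} \<Longrightarrow> \<phi> s = \<phi> x + of_int m * (s - x)"
  shows "rgerm \<phi> t m"
proof (rule rgermI[of "y - t"])
  fix s assume "0 < s" "s < y - t"
  with assms(1,2) assms(3)[of "t + s"] assms(3)[of t]
  show "\<phi> (t + s) = \<phi> t + of_int m * s" by (simp add: algebra_simps)
qed (use assms in auto)

lemma rgerm_linear_rev:
  assumes "x < t" "t \<le> y" "\<And>s. s \<in> {x..y} \<Longrightarrow> \<phi> s = \<phi> x + of_int m * (s - x)"
  shows "rgerm (\<lambda>s. \<phi> (L - s)) (L - t) (- m)"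
proof (rule rgermI[of "t - x"])
  fix s assume "0 < s" "s < t - x"
  with assms(1,2) assms(3)[of "t - s"] assms(3)[of t]
  show "\<phi> (L - (L - t + s)) = \<phi> (L - (L - t)) + of_int (- m) * s" by (simp add: algebra_simps)
qed (use assms in auto)

section \<open>Piecewise linear functions with integer slopes on an interval\<close>

text \<open>Induction over the pieces: a property of intervals holds for the whole interval if it holds
  wherever \<open>g\<close> is affine and is preserved when adjacent intervals are joined.\<close>

lemma pl_int_slopes_induct [consumes 2, case_names linear concat]:
  assumes "pl_int_slopes a b g" "a < b"
    and lin: "\<And>x y m. \<lbrakk>a \<le> x; x < y; y \<le> b; \<And>t. t \<in> {x..y} \<Longrightarrow> g t = g x + of_int m * (t - x)\<rbrakk>
      \<Longrightarrow> P x y"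
    and concat: "\<And>x y z. \<lbrakk>a \<le> x; x < y; y < z; z \<le> b; P x y; P y z\<rbrakk> \<Longrightarrow> P x z"
  shows "P a b"
proof -
  obtain B where B: "finite B" "\<And>x y. \<lbrakk>a \<le> x; x < y; y \<le> b; {x<..<y} \<inter> B = {}\<rbrakk> \<Longrightarrow>
      \<exists>m::int. \<forall>t\<in>{x..y}. g t = g x + of_int m * (t - x)"
    using assms(1) unfolding pl_int_slopes_def by blast
  have "P x y" if "a \<le> x" "x < y" "y \<le> b" for x y
    using that
  proof (induction "card ({x<..<y} \<inter> B)" arbitrary: x y rule: less_induct)
    case less
    show ?case
    proof (cases "{x<..<y} \<inter> B = {}")
      case True
      with B(2)[of x y] less.prems obtain m :: int
        where "\<forall>t\<in>{x..y}. g t = g x + of_int m * (t - x)" by blast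
      then show ?thesis by (intro lin[OF less.prems, of m]) (rule bspec)
    next
      case False
      then obtain z where z: "z \<in> B" "x < z" "z < y" by auto
      have "{x<..<z} \<inter> B \<subset> {x<..<y} \<inter> B" "{z<..<y} \<inter> B \<subset> {x<..<y} \<inter> B"
        using z by auto
      then have "card ({x<..<z} \<inter> B) < card ({x<..<y} \<inter> B)"
        "card ({z<..<y} \<inter> B) < card ({x<..<y} \<inter> B)"
        using B(1) by (auto intro!: psubset_card_mono)
      then have "P x z" "P z y" using less z by auto
      with z less.prems show ?thesis by (intro concat[of x z y]) auto
    qed
  qed
  then show ?thesis using \<open>a < b\<close> by auto
qed

lemma pl_int_slopes_linear:
  assumes "\<And>t. t \<in> {x..y} \<Longrightarrow> g t = g x + of_int (m::int) * (t - x)"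
  shows "pl_int_slopes x y g"
  unfolding pl_int_slopes_def
proof (intro exI[of _ "{}"] conjI allI impI)
  fix x' y' :: real assume *: "x \<le> x' \<and> x' < y' \<and> y' \<le> y \<and> {x'<..<y'} \<inter> {} = {}"
  show "\<exists>m::int. \<forall>t\<in>{x'..y'}. g t = g x' + of_int m * (t - x')"
  proof (intro exI[of _ m] ballI)
    fix t assume "t \<in> {x'..y'}"
    with * assms[of t] assms[of x'] show "g t = g x' + of_int m * (t - x')"
      by (auto simp: algebra_simps)
  qed
qed auto

lemma pl_int_slopes_subinterval:
  assumes "pl_int_slopes a b g" "a \<le> x" "x < y" "y \<le> b"
  shows "pl_int_slopes x y g"
proof -
  obtain B where B: "finite B" "\<And>x y. \<lbrakk>a \<le> x; x < y; y \<le> b; {x<..<y} \<inter> B = {}\<rbrakk> \<Longrightarrow>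
      \<exists>m::int. \<forall>t\<in>{x..y}. g t = g x + of_int m * (t - x)"
    using assms(1) unfolding pl_int_slopes_def by blast
  show ?thesis
    unfolding pl_int_slopes_def
  proof (intro exI[of _ B] conjI allI impI)
    fix x' y' assume "x \<le> x' \<and> x' < y' \<and> y' \<le> y \<and> {x'<..<y'} \<inter> B = {}"
    then show "\<exists>m::int. \<forall>t\<in>{x'..y'}. g t = g x' + of_int m * (t - x')"
      using assms by (intro B(2)) auto
  qed (rule B(1))
qed

lemma pl_int_slopes_concat:
  assumes "pl_int_slopes x y g" "pl_int_slopes y z g"
  shows "pl_int_slopes x z g"
proof -
  obtain B where B: "finite B" "\<And>x' y'. \<lbrakk>x \<le> x'; x' < y'; y' \<le> y; {x'<..<y'} \<inter> B = {}\<rbrakk> \<Longrightarrow>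
      \<exists>m::int. \<forall>t\<in>{x'..y'}. g t = g x' + of_int m * (t - x')"
    using assms(1) unfolding pl_int_slopes_def by blast
  obtain C where C: "finite C" "\<And>x' y'. \<lbrakk>y \<le> x'; x' < y'; y' \<le> z; {x'<..<y'} \<inter> C = {}\<rbrakk> \<Longrightarrow>
      \<exists>m::int. \<forall>t\<in>{x'..y'}. g t = g x' + of_int m * (t - x')"
    using assms(2) unfolding pl_int_slopes_def by blast
  show ?thesis
    unfolding pl_int_slopes_def
  proof (intro exI[of _ "B \<union> C \<union> {y}"] conjI allI impI)
    fix x' y' :: real
    assume *: "x \<le> x' \<and> x' < y' \<and> y' \<le> z \<and> {x'<..<y'} \<inter> (B \<union> C \<union> {y}) = {}"
    then have "y \<notin> {x'<..<y'}" by blast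
    then have "y' \<le> y \<or> y \<le> x'" by auto
    then show "\<exists>m::int. \<forall>t\<in>{x'..y'}. g t = g x' + of_int m * (t - x')"
    proof
      assume "y' \<le> y"
      with * show ?thesis by (intro B(2)) auto
    next
      assume "y \<le> x'"
      with * show ?thesis by (intro C(2)) auto
    qed
  qed (use B(1) C(1) in simp)
qed

lemma pl_int_slopes_continuous:
  assumes "pl_int_slopes a b g" "a < b"
  shows "continuous_on {a..b} g"
  using assms
proof (induction rule: pl_int_slopes_induct)
  case (linear x y m)
  have "continuous_on {x..y} (\<lambda>t. g x + of_int m * (t - x))"
    by (intro continuous_intros)
  then show ?case
    by (subst continuous_on_cong[OF refl linear(4)]) auto
next
  case (concat x y z)
  then have "continuous_on ({x..y} \<union> {y..z}) g"
    by (intro continuous_on_closed_Un) auto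
  then show ?case using concat by (simp add: ivl_disj_un_two_touch)
qed

lemma pl_int_slopes_rgerm:
  assumes "pl_int_slopes a b g" "a \<le> t" "t < b"
  shows "\<exists>m. rgerm g t m"
proof -
  have "a < b" using assms by simp
  with assms(1) have "\<forall>t. a \<le> t \<and> t < b \<longrightarrow> (\<exists>m. rgerm g t m)"
  proof (induction rule: pl_int_slopes_induct)
    case (linear x y m)
    show ?case
    proof (intro allI impI exI[of _ m])
      fix t assume "x \<le> t \<and> t < y"
      then show "rgerm g t m" by (intro rgerm_linear[OF _ _ linear(4)]) auto
    qed
  next
    case (concat x y z)
    show ?case
    proof (intro allI impI)
      fix t assume "x \<le> t \<and> t < z"
      then show "\<exists>m. rgerm g t m" using concat by (cases "t < y") auto
    qed
  qed
  with assms show ?thesis by blast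
qed

text \<open>Conversely, having an integer slope to both sides of every point is enough: by compactness
  finitely many pieces suffice. So piecewise linearity may be checked locally.\<close>

lemma pl_int_slopes_rgermI:
  assumes "0 < L"
    and r: "\<And>t. 0 \<le> t \<Longrightarrow> t < L \<Longrightarrow> \<exists>m. rgerm g t m"
    and l: "\<And>t. 0 \<le> t \<Longrightarrow> t < L \<Longrightarrow> \<exists>m. rgerm (\<lambda>s. g (L - s)) t m"
  shows "pl_int_slopes 0 L g"
proof -
  have trivial: "pl_int_slopes x y g" if "y \<le> x" for x y
    using that unfolding pl_int_slopes_def by (intro exI[of _ "{}"]) auto
  have "pl_int_slopes (max 0 0) (min L L) g"
    using less_imp_le[OF \<open>0 < L\<close>]
  proof (induction rule: Bolzano[where P = "\<lambda>a b. pl_int_slopes (max 0 a) (min L b) g"])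
    case (trans a b c)
    note 2 = trans
    show ?case
    proof (cases "0 \<le> b \<and> b \<le> L")
      case True
      with 2 show ?thesis by (auto intro: pl_int_slopes_concat)
    next
      case False
      with 2 \<open>0 < L\<close> show ?thesis
        by (auto simp: max_def min_def split: if_splits)
    qed
  next
    case (local x)
    note 3 = local
    have "\<exists>e>0. \<exists>m::int. x < L \<longrightarrow> (\<forall>s. 0 \<le> s \<and> s \<le> e \<longrightarrow> g (x + s) = g x + of_int m * s)"
    proof (cases "x < L")
      case True
      with r[of x] 3 obtain m where "rgerm g x m" by auto
      then obtain e where "0 < e" "\<And>s. 0 \<le> s \<Longrightarrow> s \<le> e \<Longrightarrow> g (x + s) = g x + of_int m * s"
        by (rule rgermE) blast
      then show ?thesis by blast
    qed (auto intro: zero_less_one)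
    then obtain e m where e: "e > 0"
      "\<And>s. x < L \<Longrightarrow> 0 \<le> s \<Longrightarrow> s \<le> e \<Longrightarrow> g (x + s) = g x + of_int (m::int) * s" by blast
    have "\<exists>d>0. \<exists>k::int. 0 < x \<longrightarrow> (\<forall>s. 0 \<le> s \<and> s \<le> d \<longrightarrow> g (x - s) = g x + of_int k * s)"
    proof (cases "0 < x")
      case True
      with l[of "L - x"] 3 obtain k where "rgerm (\<lambda>s. g (L - s)) (L - x) k" by auto
      then obtain d where "0 < d"
        "\<And>s. 0 \<le> s \<Longrightarrow> s \<le> d \<Longrightarrow> g (L - (L - x + s)) = g (L - (L - x)) + of_int k * s"
        by (rule rgermE) blast
      then show ?thesis by (intro exI[of _ d] conjI exI[of _ k]) auto
    qed (auto intro: zero_less_one)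
    then obtain d k where d: "d > 0"
      "\<And>s. 0 < x \<Longrightarrow> 0 \<le> s \<Longrightarrow> s \<le> d \<Longrightarrow> g (x - s) = g x + of_int (k::int) * s" by blast
    show ?case
    proof (intro exI[of _ "min d e"] conjI allI impI)
      fix a b assume ab: "a \<le> x \<and> x \<le> b \<and> b - a < min d e"
      have "pl_int_slopes x (min L b) g"
      proof (cases "x < L")
        case True
        have "g t = g x + of_int m * (t - x)" if "t \<in> {x..min L b}" for t
          using e(2)[OF True, of "t - x"] that ab by auto
        then show ?thesis by (rule pl_int_slopes_linear)
      qed (auto intro: trivial)
      moreover have "pl_int_slopes (max 0 a) x g"
      proof (cases "0 < x")
        case True
        have *: "g t = g x + of_int k * (x - t)" if "t \<in> {max 0 a..x}" for t
          using d(2)[OF True, of "x - t"] that ab by auto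
        show ?thesis
        proof (rule pl_int_slopes_linear[where m = "- k"])
          fix t assume "t \<in> {max 0 a..x}"
          with *[of t] *[of "max 0 a"] True ab
          show "g t = g (max 0 a) + of_int (- k) * (t - max 0 a)"
            by (simp add: algebra_simps)
        qed
      qed (use 3 in \<open>auto intro: trivial\<close>)
      ultimately show "pl_int_slopes (max 0 a) (min L b) g"
        by (rule pl_int_slopes_concat[rotated])
    qed (use d(1) e(1) in auto)
  qed
  then show ?thesis by simp
qed

text \<open>The one-dimensional reason why principal divisors have degree zero.\<close>

lemma sum_slope_changes:
  assumes "pl_int_slopes 0 L g" "0 < L"
    and r: "\<And>t. 0 \<le> t \<Longrightarrow> t < L \<Longrightarrow> rgerm g t (r t)"
    and l: "\<And>t. 0 < t \<Longrightarrow> t \<le> L \<Longrightarrow> rgerm (\<lambda>s. g (L - s)) (L - t) (l t)"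
    and "finite T" "\<And>t. 0 < t \<Longrightarrow> t < L \<Longrightarrow> t \<notin> T \<Longrightarrow> r t + l t = 0"
  shows "r 0 + l L + (\<Sum>t\<in>T \<inter> {0<..<L}. r t + l t) = 0"
  using assms(1,2)
proof (induction rule: pl_int_slopes_induct[where P =
      "\<lambda>x y. r x + l y + (\<Sum>t\<in>T \<inter> {x<..<y}. r t + l t) = 0"])
  case (linear x y m)
  have rm: "r t = m" if "x \<le> t" "t < y" for t
    using that r[of t] linear(1-3) by (intro rgerm_unique[OF _ rgerm_linear[OF _ _ linear(4)]]) auto
  have lm: "l t = - m" if "x < t" "t \<le> y" for t
    using that l[of t] linear(1-3)
    by (intro rgerm_unique[OF _ rgerm_linear_rev[OF _ _ linear(4)]]) auto
  have "(\<Sum>t\<in>T \<inter> {x<..<y}. r t + l t) = 0"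
    using rm lm by (intro sum.neutral) auto
  with rm[of x] lm[of y] linear(1-3) show ?case by simp
next
  case (concat x y z)
  have *: "T \<inter> {x<..<z} = (T \<inter> {x<..<y}) \<union> (T \<inter> {y<..<z}) \<union> (T \<inter> {y})"
    using concat by auto
  have "(\<Sum>t\<in>T \<inter> {x<..<z}. r t + l t) = (\<Sum>t\<in>T \<inter> {x<..<y}. r t + l t)
      + (\<Sum>t\<in>T \<inter> {y<..<z}. r t + l t) + (\<Sum>t\<in>T \<inter> {y}. r t + l t)"
    unfolding * using \<open>finite T\<close> by (simp add: sum.union_disjoint disjoint_iff)
  moreover have "(\<Sum>t\<in>T \<inter> {y}. r t + l t) = r y + l y"
    using assms(6)[of y] concat by (cases "y \<in> T") auto
  ultimately show ?case using concat by linarith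
qed

text \<open>If the outgoing slopes at every interior point have a nonnegative sum, then \<open>g\<close> is convex,
  so its slopes increase and its tangents lie below it.\<close>

lemma convex_slopes:
  assumes "pl_int_slopes 0 L g" "0 < L"
    and r: "\<And>t. 0 \<le> t \<Longrightarrow> t < L \<Longrightarrow> rgerm g t (r t)"
    and l: "\<And>t. 0 < t \<Longrightarrow> t \<le> L \<Longrightarrow> rgerm (\<lambda>s. g (L - s)) (L - t) (l t)"
    and c: "\<And>t. 0 < t \<Longrightarrow> t < L \<Longrightarrow> 0 \<le> r t + l t"
    and xy: "0 \<le> x" "x < y" "y \<le> L"
  shows "r x \<le> - l y" "g x + of_int (r x) * (y - x) \<le> g y" "g y + of_int (l y) * (y - x) \<le> g x"
proof -
  have pl: "pl_int_slopes x y g"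
    using assms(1) xy by (rule pl_int_slopes_subinterval)
  have "r x \<le> - l y \<and> g x + of_int (r x) * (y - x) \<le> g y \<and> g y + of_int (l y) * (y - x) \<le> g x"
    using pl \<open>x < y\<close>
  proof (induction rule: pl_int_slopes_induct[where P = "\<lambda>x y. r x \<le> - l y \<and>
      g x + of_int (r x) * (y - x) \<le> g y \<and> g y + of_int (l y) * (y - x) \<le> g x"])
    case (linear x' y' m)
    have "r x' = m"
      using r[of x'] linear(1-3) xy by (intro rgerm_unique[OF _ rgerm_linear[OF _ _ linear(4)]]) auto
    moreover have "l y' = - m"
      using l[of y'] linear(1-3) xy
      by (intro rgerm_unique[OF _ rgerm_linear_rev[OF _ _ linear(4)]]) auto
    moreover have "g y' = g x' + of_int m * (y' - x')"
      using linear(1-3) by (intro linear(4)) auto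
    ultimately show ?case by simp
  next
    case (concat x' y' z)
    have "0 \<le> r y' + l y'" using c[of y'] concat xy by auto
    then have *: "r x' \<le> r y'" "l z \<le> l y'" using concat by auto
    have "of_int (r x') * (z - y') \<le> of_int (r y') * (z - y')"
      "of_int (l z) * (y' - x') \<le> of_int (l y') * (y' - x')"
      using concat * by (auto intro!: mult_right_mono)
    moreover have "g x' + of_int (r x') * (y' - x') \<le> g y'" "g y' + of_int (l y') * (y' - x') \<le> g x'"
      "g y' + of_int (r y') * (z - y') \<le> g z" "g z + of_int (l z) * (z - y') \<le> g y'"
      "r y' \<le> - l z"
      using concat by auto
    ultimately show ?case using * by (auto simp: algebra_simps)
  qed
  then show "r x \<le> - l y" "g x + of_int (r x) * (y - x) \<le> g y" "g y + of_int (l y) * (y - x) \<le> g x"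
    by auto
qed

section \<open>Points and branches of a metric graph\<close>

text \<open>The metric realization of a finite simple graph with positive edge lengths. Connectedness is not
  part of the definition; it is assumed only where it is needed.\<close>

locale metric_graph =
  fixes G :: "'a wgraph"
  assumes finite_verts: "finite (verts G)"
    and edges_sub: "edges G \<subseteq> [verts G]\<^bsup>2\<^esup>"
    and len_pos: "e \<in> edges G \<Longrightarrow> 0 < len G e"
begin

abbreviation "adj u v \<equiv> {u, v} \<in> edges G"
abbreviation "ep \<equiv> edge_point G"
abbreviation "elen u v \<equiv> len G {u, v}"
abbreviation "slope f u v t \<equiv> outgoing_slope G f (u, v, t)"

lemma adjD:
  assumes "adj u v"
  shows "u \<noteq> v" "u \<in> verts G" "v \<in> verts G" "0 < elen u v" "adj v u" "elen v u = elen u v"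
  using subsetD[OF edges_sub assms] len_pos[OF assms] assms by (auto simp: insert_commute)

lemma finite_edges: "finite (edges G)"
  using finite_imp_finite_nsets[OF finite_verts] edges_sub by (rule rev_finite_subset)

lemma finite_arcs: "finite {(u, v). adj u v}"
  by (rule finite_subset[of _ "verts G \<times> verts G"]) (use adjD finite_verts in auto)

lemma finite_nbrs: "finite {v. adj u v}"
  by (rule finite_subset[of _ "verts G"]) (use adjD finite_verts in auto)

lemma ep_reverse: "adj u v \<Longrightarrow> ep u v (elen u v - t) = ep v u t"
  using edge_point_reverse[of v u G t] adjD[of u v] by simp

lemma ep_start: "adj u v \<Longrightarrow> ep u v 0 = vertex_point u"
  using edge_point_ends(1) adjD by metis

lemma ep_end: "adj u v \<Longrightarrow> ep u v (elen u v) = vertex_point v"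
  using edge_point_ends(2) adjD by metis

lemma ep_in_points: "adj u v \<Longrightarrow> 0 \<le> t \<Longrightarrow> t \<le> elen u v \<Longrightarrow> ep u v t \<in> points G"
  unfolding points_def by blast

lemma vertex_in_points: "u \<in> verts G \<Longrightarrow> vertex_point u \<in> points G"
  unfolding points_def by blast

lemma vertex_point_eq_iff [simp]: "vertex_point u = vertex_point v \<longleftrightarrow> u = v"
proof
  assume "vertex_point u = vertex_point v"
  then have "vertex_point u u = vertex_point v u" by simp
  then show "u = v" by (auto simp: vertex_point_def split: if_splits)
qed simp

lemma ep_inj:
  assumes "adj u v" "ep u v s = ep u v t"
  shows "s = t"
proof -
  have "ep u v s v = ep u v t v" using assms(2) by simp
  then show ?thesis using adjD[OF assms(1)] by (auto simp: edge_point_def split: if_splits)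
qed

lemma vertex_point_support: "{w. vertex_point u w \<noteq> 0} = {u}"
  by (auto simp: vertex_point_def)

lemma ep_support:
  assumes "adj u v" "0 < t" "t < elen u v"
  shows "{w. ep u v t w \<noteq> 0} = {u, v}"
  using assms adjD by (intro edge_point_in_interior) auto

lemma ep_eq_vertex:
  assumes "adj u v" "0 \<le> t" "t \<le> elen u v" "ep u v t = vertex_point w"
  shows "t = 0 \<and> w = u \<or> t = elen u v \<and> w = v"
proof (cases "t = 0 \<or> t = elen u v")
  case True
  then show ?thesis using assms ep_start ep_end by force
next
  case False
  then have "{u, v} = {w}"
    using ep_support[of u v t] assms vertex_point_support[of w] by auto
  then show ?thesis using adjD[OF assms(1)] by auto
qed

lemma ep_eq_interior:
  assumes "adj u v" "0 < t" "t < elen u v" "adj u' v'" "0 \<le> t'" "t' \<le> elen u' v'"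
    and eq: "ep u' v' t' = ep u v t"
  shows "u' = u \<and> v' = v \<and> t' = t \<or> u' = v \<and> v' = u \<and> t' = elen u v - t"
proof -
  have "\<not> (t' = 0 \<or> t' = elen u' v')"
  proof
    assume "t' = 0 \<or> t' = elen u' v'"
    then obtain w where "ep u v t = vertex_point w"
      using eq ep_start ep_end assms(4) by metis
    with ep_eq_vertex[of u v t w] assms(1-3) show False by auto
  qed
  with assms have "{u', v'} = {u, v}"
    using ep_support[of u v t] ep_support[of u' v' t'] by auto
  then consider "u' = u" "v' = v" | "u' = v" "v' = u" by (auto simp: doubleton_eq_iff)
  then show ?thesis
  proof cases
    case 1
    with eq ep_inj assms(1) show ?thesis by blast
  next
    case 2
    then have "ep v u t' = ep v u (elen u v - t)"
      using eq ep_reverse[of v u t] adjD[OF assms(1)] by simp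
    with 2 show ?thesis using ep_inj adjD(5)[OF assms(1)] by blast
  qed
qed

lemma point_cases:
  assumes "p \<in> points G"
  obtains (vertex) u where "u \<in> verts G" "p = vertex_point u"
  | (interior) u v t where "adj u v" "0 < t" "t < elen u v" "p = ep u v t"
proof (cases "p \<in> vertex_point ` verts G")
  case True
  with vertex show thesis by blast
next
  case False
  with assms obtain u v t where *: "p = ep u v t" "adj u v" "0 \<le> t" "t \<le> elen u v"
    unfolding points_def by blast
  have "t \<noteq> 0" "t \<noteq> elen u v"
    using * False ep_start ep_end adjD by blast+
  with * show thesis by (intro interior[of u v t]) auto
qed

lemma branches_vertex: "branches G (vertex_point u) = (\<lambda>v. (u, v, 0 :: real)) ` {v. adj u v}"
proof (intro equalityI subsetI)
  fix b assume "b \<in> branches G (vertex_point u)"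
  then obtain x y t where *: "b = (x, y, t)" "adj x y" "0 \<le> t" "t < elen x y"
    "ep x y t = vertex_point u" unfolding branches_def by blast
  from ep_eq_vertex[of x y t u] * have "t = 0" "x = u" by auto
  with * show "b \<in> (\<lambda>v. (u, v, 0 :: real)) ` {v. adj u v}" by auto
next
  fix b assume "b \<in> (\<lambda>v. (u, v, 0 :: real)) ` {v. adj u v}"
  then show "b \<in> branches G (vertex_point u)"
    using ep_start adjD unfolding branches_def by auto
qed

lemma branches_interior:
  assumes "adj u v" "0 < t" "t < elen u v"
  shows "branches G (ep u v t) = {(u, v, t), (v, u, elen u v - t)}"
proof (intro equalityI subsetI)
  fix b assume "b \<in> branches G (ep u v t)"
  then obtain x y s where *: "b = (x, y, s)" "adj x y" "0 \<le> s" "s < elen x y" "ep x y s = ep u v t"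
    unfolding branches_def by blast
  from ep_eq_interior[of u v t x y s] * assms
  show "b \<in> {(u, v, t), (v, u, elen u v - t)}" by auto
next
  fix b assume "b \<in> {(u, v, t), (v, u, elen u v - t)}"
  then show "b \<in> branches G (ep u v t)"
    using assms ep_reverse[of v u t] adjD[OF assms(1)] unfolding branches_def by auto
qed

lemma branches_outside: "p \<notin> points G \<Longrightarrow> branches G p = {}"
  unfolding branches_def using ep_in_points by fastforce

lemma div_of_vertex: "div_of G f (vertex_point u) = (\<Sum>v | adj u v. slope f u v 0)"
  unfolding div_of_def branches_vertex
  by (subst sum.reindex) (auto simp: inj_on_def)

lemma div_of_interior:
  assumes "adj u v" "0 < t" "t < elen u v"
  shows "div_of G f (ep u v t) = slope f u v t + slope f v u (elen u v - t)"
  unfolding div_of_def branches_interior[OF assms]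
  using adjD[OF assms(1)] by simp

lemma div_of_outside: "p \<notin> points G \<Longrightarrow> div_of G f p = 0"
  unfolding div_of_def by (simp add: branches_outside)

section \<open>Rational functions and their divisors\<close>

lemma rational_pl:
  "rational_function G f \<Longrightarrow> adj u v \<Longrightarrow> pl_int_slopes 0 (elen u v) (\<lambda>s. f (ep u v s))"
  unfolding rational_function_def by blast

lemma slope_eqI: "rgerm (\<lambda>s. f (ep u v s)) t m \<Longrightarrow> slope f u v t = m"
  by (intro outgoing_slope_eqI rgerm_has_derivative)

lemma rational_rgerm:
  assumes "rational_function G f" "adj u v" "0 \<le> t" "t < elen u v"
  shows "rgerm (\<lambda>s. f (ep u v s)) t (slope f u v t)"
  using pl_int_slopes_rgerm[OF rational_pl[OF assms(1,2)] assms(3,4)] slope_eqI by metis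

lemma rational_rgerm_rev:
  assumes "rational_function G f" "adj u v" "0 < t" "t \<le> elen u v"
  shows "rgerm (\<lambda>s. f (ep u v (elen u v - s))) (elen u v - t) (slope f v u (elen u v - t))"
  using rational_rgerm[of f v u "elen u v - t"] assms adjD[of u v] by (simp add: ep_reverse)

text \<open>The closed edge in barycentric coordinates; the arc length parameter of its point \<open>p\<close> is
  \<open>elen u v * p v\<close>.\<close>

lemma edge_image:
  assumes "adj u v"
  shows "ep u v ` {0..elen u v} =
    {p. (\<forall>w. w \<noteq> u \<longrightarrow> w \<noteq> v \<longrightarrow> p w = 0) \<and> p u + p v = 1 \<and> 0 \<le> p v \<and> p v \<le> 1}"
    (is "_ = ?R")
proof (intro equalityI subsetI)
  fix p assume "p \<in> ep u v ` {0..elen u v}"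
  then show "p \<in> ?R" using adjD[OF assms] by (auto simp: edge_point_def)
next
  fix p assume p: "p \<in> ?R"
  then have "p = ep u v (elen u v * p v)"
    using adjD[OF assms] by (auto simp: edge_point_def fun_eq_iff)
  moreover have "elen u v * p v \<in> {0..elen u v}"
    using p adjD[OF assms] by (auto intro: mult_left_le)
  ultimately show "p \<in> ep u v ` {0..elen u v}" by blast
qed

lemma closed_edge_image:
  assumes "adj u v"
  shows "closed (ep u v ` {0..elen u v})"
  unfolding edge_image[OF assms]
  by (intro closed_Collect_conj closed_Collect_all closed_Collect_imp closed_Collect_eq
      closed_Collect_le continuous_intros open_Collect_const) auto

lemma closed_vertex: "closed {vertex_point u}"
proof -
  have "{vertex_point u} = {p. \<forall>w. p w = vertex_point u w}" by (auto simp: fun_eq_iff)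
  also have "closed \<dots>"
    by (intro closed_Collect_all closed_Collect_eq continuous_intros) auto
  finally show ?thesis .
qed

text \<open>A function is rational as soon as it has an integer slope along every branch: the closed edges
  are finitely many closed sets covering the space, and on each of them \<open>f\<close> is a continuous function of
  a barycentric coordinate.\<close>

lemma rational_functionI:
  assumes "\<And>u v t. adj u v \<Longrightarrow> 0 \<le> t \<Longrightarrow> t < elen u v \<Longrightarrow> \<exists>m. rgerm (\<lambda>s. f (ep u v s)) t m"
  shows "rational_function G f"
proof -
  have pl: "pl_int_slopes 0 (elen u v) (\<lambda>t. f (ep u v t))" if "adj u v" for u v
  proof (rule pl_int_slopes_rgermI)
    fix t assume "0 \<le> t" "t < elen u v"
    then show "\<exists>m. rgerm (\<lambda>s. f (ep u v (elen u v - s))) t m"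
      using assms[of v u t] adjD[OF that] ep_reverse[OF that] by simp
  qed (use that assms adjD in auto)
  have cont: "continuous_on (ep u v ` {0..elen u v}) f" if "adj u v" for u v
  proof -
    have "continuous_on (ep u v ` {0..elen u v}) (\<lambda>p. f (ep u v (elen u v * p v)))"
    proof (rule continuous_on_compose2[OF pl_int_slopes_continuous[OF pl[OF that]]])
      show "continuous_on (ep u v ` {0..elen u v}) (\<lambda>p. elen u v * p v)"
        by (intro continuous_intros continuous_on_subset[OF continuous_on_product_coordinates]) auto
      show "(\<lambda>p. elen u v * p v) ` ep u v ` {0..elen u v} \<subseteq> {0..elen u v}"
        using adjD[OF that] by (auto simp: edge_point_def)
    qed (use adjD that in auto)
    moreover have "f (ep u v (elen u v * p v)) = f p" if "p \<in> ep u v ` {0..elen u v}" for p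
    proof -
      from that obtain x where x: "p = ep u v x" by blast
      then have "elen u v * p v = x"
        using adjD[OF \<open>adj u v\<close>] by (simp add: edge_point_def)
      with x show ?thesis by simp
    qed
    ultimately show ?thesis by (simp cong: continuous_on_cong)
  qed
  define A where "A = (\<lambda>u. {vertex_point u}) ` verts G \<union>
    (\<lambda>(u, v). ep u v ` {0..elen u v}) ` {(u, v). adj u v}"
  have "continuous_on (\<Union>X\<in>A. X) f"
  proof (rule continuous_on_closed_Union)
    show "finite A" unfolding A_def using finite_verts finite_arcs by simp
  qed (auto simp: A_def closed_vertex closed_edge_image cont)
  moreover have "points G = (\<Union>X\<in>A. X)"
    unfolding A_def points_def by auto blast
  ultimately show ?thesis
    unfolding rational_function_def using pl by simp
qed

lemma rational_const: "rational_function G (\<lambda>p. c)"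
  by (rule rational_functionI) (auto intro: rgerm_const)

lemma slope_const: "slope (\<lambda>p. c) u v t = 0"
  by (rule slope_eqI) (rule rgerm_const)

lemma div_of_const: "div_of G (\<lambda>p. c) p = 0"
  unfolding div_of_def by (rule sum.neutral) (auto simp: slope_const)

lemma rational_add:
  assumes "rational_function G f" "rational_function G g"
  shows "rational_function G (\<lambda>p. f p + g p)"
  by (rule rational_functionI) (use rgerm_add rational_rgerm assms in blast)

lemma rational_uminus:
  assumes "rational_function G f"
  shows "rational_function G (\<lambda>p. - f p)"
  by (rule rational_functionI) (use rgerm_uminus rational_rgerm assms in blast)

lemma slope_add:
  assumes "rational_function G f" "rational_function G g" "adj u v" "0 \<le> t" "t < elen u v"
  shows "slope (\<lambda>p. f p + g p) u v t = slope f u v t + slope g u v t"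
  by (intro slope_eqI rgerm_add rational_rgerm assms)

lemma slope_uminus:
  assumes "rational_function G f" "adj u v" "0 \<le> t" "t < elen u v"
  shows "slope (\<lambda>p. - f p) u v t = - slope f u v t"
  by (intro slope_eqI rgerm_uminus rational_rgerm assms)

lemma div_of_add:
  assumes "rational_function G f" "rational_function G g"
  shows "div_of G (\<lambda>p. f p + g p) p = div_of G f p + div_of G g p"
  unfolding div_of_def sum.distrib[symmetric]
  by (rule sum.cong) (auto simp: branches_def slope_add assms)

lemma div_of_uminus:
  assumes "rational_function G f"
  shows "div_of G (\<lambda>p. - f p) p = - div_of G f p"
  unfolding div_of_def sum_negf[symmetric]
  by (rule sum.cong) (auto simp: branches_def slope_uminus assms)

lemma rgerm_max_const:
  assumes "rational_function G f" "adj u v" "0 \<le> t" "t < elen u v"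
  shows "rgerm (\<lambda>s. max (f (ep u v s)) c) t
    (if f (ep u v t) > c then slope f u v t
     else if f (ep u v t) < c then 0 else max (slope f u v t) 0)"
  using rgerm_max[OF rational_rgerm[OF assms] rgerm_const] .

lemma rational_max_const:
  assumes "rational_function G f"
  shows "rational_function G (\<lambda>p. max (f p) c)"
  by (rule rational_functionI) (use rgerm_max_const[OF assms] in blast)

lemma slope_max_const:
  assumes "rational_function G f" "adj u v" "0 \<le> t" "t < elen u v"
  shows "slope (\<lambda>p. max (f p) c) u v t =
    (if f (ep u v t) > c then slope f u v t
     else if f (ep u v t) < c then 0 else max (slope f u v t) 0)"
  by (rule slope_eqI) (rule rgerm_max_const[OF assms])

text \<open>Cutting \<open>f\<close> off at the level \<open>c\<close> kills its divisor where \<open>f < c\<close> and does not decrease it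
  elsewhere.\<close>

lemma div_of_max_const:
  assumes "rational_function G f"
  shows "f p < c \<Longrightarrow> div_of G (\<lambda>p. max (f p) c) p = 0"
    and "c \<le> f p \<Longrightarrow> div_of G f p \<le> div_of G (\<lambda>p. max (f p) c) p"
  unfolding div_of_def
  by (auto intro!: sum.neutral sum_mono simp: branches_def slope_max_const assms)

lemma finite_div_support:
  assumes "rational_function G f"
  shows "finite {p. div_of G f p \<noteq> 0}"
proof -
  have "\<forall>a\<in>{(u, v). adj u v}. \<exists>B. finite B \<and>
    (\<forall>t. t \<notin> B \<longrightarrow> 0 < t \<longrightarrow> t < elen (fst a) (snd a) \<longrightarrow> div_of G f (ep (fst a) (snd a) t) = 0)"
  proof (rule ballI, clarsimp)
    fix u v assume a: "adj u v"
    from rational_pl[OF assms a] obtain B where B: "finite B"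
      "\<And>x y. \<lbrakk>0 \<le> x; x < y; y \<le> elen u v; {x<..<y} \<inter> B = {}\<rbrakk> \<Longrightarrow>
      \<exists>m::int. \<forall>t\<in>{x..y}. f (ep u v t) = f (ep u v x) + of_int m * (t - x)"
      unfolding pl_int_slopes_def by blast
    show "\<exists>B. finite B \<and> (\<forall>t. t \<notin> B \<longrightarrow> 0 < t \<longrightarrow> t < elen u v \<longrightarrow> div_of G f (ep u v t) = 0)"
    proof (intro exI[of _ B] conjI allI impI)
      fix t assume t: "t \<notin> B" "0 < t" "t < elen u v"
      obtain d where d: "d > 0" "\<And>x. x \<in> B \<Longrightarrow> x \<noteq> t \<Longrightarrow> d \<le> dist t x"
        using finite_set_avoid[OF B(1), of t] by blast
      define x y where "x = max 0 (t - d)" and "y = min (elen u v) (t + d)"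
      have xy: "0 \<le> x" "x < t" "t < y" "y \<le> elen u v" using t d(1) by (auto simp: x_def y_def)
      have "{x<..<y} \<inter> B = {}"
      proof (rule equals0I)
        fix z assume z: "z \<in> {x<..<y} \<inter> B"
        then have "d \<le> dist t z" using d(2)[of z] t(1) by auto
        then show False using z by (auto simp: x_def y_def dist_real_def)
      qed
      then obtain m :: int where
        "\<forall>t\<in>{x..y}. f (ep u v t) = f (ep u v x) + of_int m * (t - x)"
        using B(2)[of x y] xy by auto
      then have m: "\<And>t. t \<in> {x..y} \<Longrightarrow> f (ep u v t) = f (ep u v x) + of_int m * (t - x)"
        by (rule bspec)
      have "slope f u v t = m"
        by (rule slope_eqI[OF rgerm_linear[OF _ xy(3) m]]) (use xy in auto)
      moreover have "slope f v u (elen u v - t) = - m"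
        using rgerm_linear_rev[OF xy(2) less_imp_le[OF xy(3)] m, of "elen u v"]
        by (intro slope_eqI) (simp add: ep_reverse[OF a])
      ultimately show "div_of G f (ep u v t) = 0"
        using div_of_interior[OF a t(2,3)] by simp
    qed (rule B(1))
  qed
  from bchoice[OF this] obtain B where B': "\<forall>a\<in>{(u, v). adj u v}. finite (B a) \<and>
    (\<forall>t. t \<notin> B a \<longrightarrow> 0 < t \<longrightarrow> t < elen (fst a) (snd a) \<longrightarrow> div_of G f (ep (fst a) (snd a) t) = 0)"
    by blast
  have B: "finite (B (u, v))"
    "\<And>t. t \<notin> B (u, v) \<Longrightarrow> 0 < t \<Longrightarrow> t < elen u v \<Longrightarrow> div_of G f (ep u v t) = 0"
    if "adj u v" for u v
    using bspec[OF B', of "(u, v)"] that by auto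
  have "{p. div_of G f p \<noteq> 0} \<subseteq> vertex_point ` verts G \<union>
    (\<Union>(u, v)\<in>{(u, v). adj u v}. ep u v ` B (u, v))"
  proof
    fix p assume p: "p \<in> {p. div_of G f p \<noteq> 0}"
    then have "p \<in> points G" using div_of_outside by blast
    then show "p \<in> vertex_point ` verts G \<union> (\<Union>(u, v)\<in>{(u, v). adj u v}. ep u v ` B (u, v))"
    proof (cases rule: point_cases)
      case (interior u v t)
      with p B(2)[of u v t] have "t \<in> B (u, v)" by auto
      with interior show ?thesis by auto
    qed auto
  qed
  moreover have "finite (vertex_point ` verts G \<union> (\<Union>(u, v)\<in>{(u, v). adj u v}. ep u v ` B (u, v)))"
    using finite_verts finite_arcs B(1) by auto
  ultimately show ?thesis by (rule finite_subset)
qed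

text \<open>Principal divisors have degree zero. The sum over all points is rearranged into a sum over
  oriented edges, and the contributions of the two orientations of an edge cancel.\<close>

lemma sum_div_of:
  assumes "rational_function G f" "finite P" "{p. div_of G f p \<noteq> 0} \<subseteq> P"
  shows "(\<Sum>p\<in>P. div_of G f p) = 0"
proof -
  define Q where "Q = P \<union> vertex_point ` verts G"
  have finQ: "finite Q" unfolding Q_def using assms(2) finite_verts by simp
  define T where "T u v = {t. 0 \<le> t \<and> t < elen u v \<and> ep u v t \<in> Q}" for u v
  define T' where "T' u v = {t. 0 < t \<and> t < elen u v \<and> ep u v t \<in> Q}" for u v
  have finT': "finite (T' u v)" if "adj u v" for u v
  proof (rule finite_imageD)
    show "finite (ep u v ` T' u v)" by (rule finite_subset[OF _ finQ]) (auto simp: T'_def)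
    show "inj_on (ep u v) (T' u v)" using ep_inj[OF that] by (auto intro: inj_onI)
  qed
  have T: "T u v = insert 0 (T' u v)" if "adj u v" for u v
    using adjD[OF that] ep_start[OF that] by (auto simp: T_def T'_def Q_def)
  have finT: "finite (T u v)" if "adj u v" for u v
    using T[OF that] finT'[OF that] by simp
  have fin_br: "finite (branches G p)" for p
  proof (cases "p \<in> points G")
    case True
    then show ?thesis
      by (cases rule: point_cases) (auto simp: branches_vertex branches_interior finite_nbrs)
  qed (simp add: branches_outside)
  have UN: "(\<Union>p\<in>Q. branches G p) = (\<Union>(u, v)\<in>{(u, v). adj u v}. (\<lambda>t. (u, v, t)) ` T u v)"
    unfolding branches_def T_def by auto
  have "(\<Sum>p\<in>P. div_of G f p) = (\<Sum>p\<in>Q. div_of G f p)"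
    using assms(3) finQ unfolding Q_def by (intro sum.mono_neutral_left) auto
  also have "\<dots> = (\<Sum>b\<in>(\<Union>p\<in>Q. branches G p). outgoing_slope G f b)"
    unfolding div_of_def using finQ fin_br
    by (subst sum.UNION_disjoint) (auto simp: branches_def)
  also have "\<dots> = (\<Sum>(u, v)\<in>{(u, v). adj u v}. \<Sum>t\<in>T u v. slope f u v t)"
    unfolding UN using finite_arcs finT
    by (subst sum.UNION_disjoint) (auto simp: case_prod_unfold sum.reindex inj_on_def intro!: sum.cong)
  also have "\<dots> = (\<Sum>(u, v)\<in>{(u, v). adj u v}. slope f u v 0 + (\<Sum>t\<in>T' u v. slope f u v t))"
    using T finT' by (intro sum.cong) (auto simp: T'_def)
  finally have 1: "(\<Sum>p\<in>P. div_of G f p) =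
    (\<Sum>(u, v)\<in>{(u, v). adj u v}. slope f u v 0 + (\<Sum>t\<in>T' u v. slope f u v t))" .
  also have "\<dots> = (\<Sum>(u, v)\<in>{(u, v). adj u v}. slope f v u 0 + (\<Sum>t\<in>T' v u. slope f v u t))"
    by (rule sum.reindex_bij_witness[of _ "\<lambda>(u, v). (v, u)" "\<lambda>(u, v). (v, u)"])
      (auto simp: insert_commute)
  finally have "2 * (\<Sum>p\<in>P. div_of G f p) =
    (\<Sum>(u, v)\<in>{(u, v). adj u v}. (slope f u v 0 + (\<Sum>t\<in>T' u v. slope f u v t))
       + (slope f v u 0 + (\<Sum>t\<in>T' v u. slope f v u t)))"
    using 1 by (simp add: case_prod_unfold sum.distrib)
  also have "\<dots> = 0"
  proof (rule sum.neutral, clarify)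
    fix u v assume a: "adj u v"
    have "slope f u v 0 + slope f v u (elen u v - elen u v) +
      (\<Sum>t\<in>T' u v \<inter> {0<..<elen u v}. slope f u v t + slope f v u (elen u v - t)) = 0"
    proof (rule sum_slope_changes[OF rational_pl[OF assms(1) a]])
      fix t assume t: "0 < t" "t < elen u v" "t \<notin> T' u v"
      then have "div_of G f (ep u v t) = 0" using assms(3) by (auto simp: T'_def Q_def)
      then show "slope f u v t + slope f v u (elen u v - t) = 0"
        using div_of_interior[OF a t(1,2)] by simp
    qed (use a adjD finT' rational_rgerm rational_rgerm_rev assms(1) in auto)
    moreover have "T' u v \<inter> {0<..<elen u v} = T' u v" by (auto simp: T'_def)
    moreover have "(\<Sum>t\<in>T' u v. slope f v u (elen u v - t)) = (\<Sum>t\<in>T' v u. slope f v u t)"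
      by (rule sum.reindex_bij_witness[of _ "\<lambda>t. elen u v - t" "\<lambda>t. elen u v - t"])
        (use ep_reverse[OF a] ep_reverse[of v u] adjD[OF a] in \<open>auto simp: T'_def\<close>)
    ultimately show "slope f u v 0 + (\<Sum>t\<in>T' u v. slope f u v t)
       + (slope f v u 0 + (\<Sum>t\<in>T' v u. slope f v u t)) = 0"
      by (simp add: sum.distrib)
  qed
  finally show ?thesis by simp
qed

end

section \<open>Divisors and linear equivalence\<close>

lemma div_degree_eq_sum:
  assumes "finite P" "Poly_Mapping.keys D \<subseteq> P"
  shows "div_degree D = (\<Sum>p\<in>P. Poly_Mapping.lookup D p)"
  unfolding div_degree_def using assms
  by (intro sum.mono_neutral_left) (auto simp: in_keys_iff)

lemma div_degree_add: "div_degree (D + E) = div_degree D + div_degree E"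
proof -
  let ?P = "Poly_Mapping.keys D \<union> Poly_Mapping.keys E"
  have "finite ?P" "Poly_Mapping.keys (D + E) \<subseteq> ?P" by (auto simp: Poly_Mapping.keys_add)
  then show ?thesis
    by (simp add: div_degree_eq_sum[of ?P] lookup_add sum.distrib)
qed

lemma div_degree_single: "div_degree (Poly_Mapping.single p n) = n"
  by (simp add: div_degree_def)

lemma div_degree_diff: "div_degree (D - E) = div_degree D - div_degree E"
  using div_degree_add[of "D - E" E] by simp

lemma div_degree_nonneg: "effective D \<Longrightarrow> 0 \<le> div_degree D"
  unfolding div_degree_def effective_def by (auto intro: sum_nonneg)

lemma lookup_le_degree:
  assumes "effective D"
  shows "Poly_Mapping.lookup D p \<le> div_degree D"
proof (cases "p \<in> Poly_Mapping.keys D")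
  case True
  then show ?thesis unfolding div_degree_def
    using assms by (intro member_le_sum) (auto simp: effective_def)
next
  case False
  then show ?thesis using div_degree_nonneg[OF assms] by (simp add: in_keys_iff)
qed

text \<open>Counts chips by the supports of their positions in barycentric coordinates: the support is
  \<open>{v}\<close> at the vertex \<open>v\<close> and \<open>{u, v}\<close> in the interior of the edge \<open>{u, v}\<close>.\<close>

lemma card_supports_le_degree:
  assumes "effective D" "X \<subseteq> (\<lambda>p. {w. p w \<noteq> 0}) ` Poly_Mapping.keys D"
  shows "int (card X) \<le> div_degree D"
proof -
  have "card X \<le> card (Poly_Mapping.keys D)"
    using surj_card_le[OF _ assms(2)] by simp
  also have "int (card (Poly_Mapping.keys D)) = (\<Sum>p\<in>Poly_Mapping.keys D. 1)" by simp
  also have "\<dots> \<le> div_degree D"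
    unfolding div_degree_def
  proof (rule sum_mono)
    fix p assume "p \<in> Poly_Mapping.keys D"
    then show "1 \<le> Poly_Mapping.lookup D p"
      using assms(1) unfolding effective_def in_keys_iff by (smt (verit))
  qed
  finally show ?thesis by simp
qed

lemma effective_add: "effective D \<Longrightarrow> effective E \<Longrightarrow> effective (D + E)"
  by (simp add: effective_def lookup_add)

lemma effective_single: "0 \<le> n \<Longrightarrow> effective (Poly_Mapping.single p n)"
  by (simp add: effective_def lookup_single when_def)

lemma effective_degree_0:
  assumes "effective D" "div_degree D = 0"
  shows "D = 0"
proof (rule poly_mapping_eqI)
  fix p show "Poly_Mapping.lookup D p = Poly_Mapping.lookup 0 p"
    using lookup_le_degree[OF assms(1), of p] assms unfolding effective_def
    by (metis antisym lookup_zero)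
qed

lemma effective_degree_1:
  assumes "effective D" "div_degree D = 1"
  obtains p where "p \<in> Poly_Mapping.keys D" "D = Poly_Mapping.single p 1"
proof -
  have "D \<noteq> 0" using assms(2) by (auto simp: div_degree_def)
  then obtain p where p: "p \<in> Poly_Mapping.keys D" by (metis all_not_in_conv keys_eq_empty)
  then have "effective (D - Poly_Mapping.single p 1)"
    using assms(1) unfolding effective_def
    by (auto simp: lookup_minus lookup_single when_def in_keys_iff order.strict_iff_order
        zless_imp_add1_zle[of 0, simplified])
  then have "D - Poly_Mapping.single p 1 = 0"
    using assms(2) by (intro effective_degree_0) (simp_all add: div_degree_diff div_degree_single)
  with p that show thesis by (metis eq_iff_diff_eq_0)
qed

lemma divisor_on_add: "divisor_on G D \<Longrightarrow> divisor_on G E \<Longrightarrow> divisor_on G (D + E)"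
  unfolding divisor_on_def using Poly_Mapping.keys_add[of D E] by blast

lemma divisor_on_diff: "divisor_on G D \<Longrightarrow> divisor_on G E \<Longrightarrow> divisor_on G (D - E)"
  unfolding divisor_on_def using Poly_Mapping.keys_diff[of D E] by blast

lemma divisor_on_single: "p \<in> points G \<Longrightarrow> divisor_on G (Poly_Mapping.single p n)"
  unfolding divisor_on_def by auto

context metric_graph
begin

lemma lin_equiv_sym:
  assumes "lin_equiv G D E"
  shows "lin_equiv G E D"
proof -
  obtain f where f: "rational_function G f" "Poly_Mapping.lookup (D - E) = div_of G f"
    using assms unfolding lin_equiv_def by blast
  have "Poly_Mapping.lookup (E - D) p = div_of G (\<lambda>p. - f p) p" for p
    using fun_cong[OF f(2), of p] by (simp add: div_of_uminus[OF f(1)] lookup_minus)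
  with rational_uminus[OF f(1)] show ?thesis unfolding lin_equiv_def by blast
qed

lemma lin_equiv_trans:
  assumes "lin_equiv G D E" "lin_equiv G E H"
  shows "lin_equiv G D H"
proof -
  obtain f where f: "rational_function G f" "Poly_Mapping.lookup (D - E) = div_of G f"
    using assms unfolding lin_equiv_def by blast
  obtain g where g: "rational_function G g" "Poly_Mapping.lookup (E - H) = div_of G g"
    using assms unfolding lin_equiv_def by blast
  have "Poly_Mapping.lookup (D - H) p = div_of G (\<lambda>p. f p + g p) p" for p
    using fun_cong[OF f(2), of p] fun_cong[OF g(2), of p]
    by (simp add: div_of_add[OF f(1) g(1)] lookup_minus)
  with rational_add[OF f(1) g(1)] show ?thesis unfolding lin_equiv_def by blast
qed

lemma lin_equiv_add: "lin_equiv G D E \<Longrightarrow> lin_equiv G (D + H) (E + H)"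
  unfolding lin_equiv_def by simp

lemma lin_equiv_degree:
  assumes "lin_equiv G D E"
  shows "div_degree D = div_degree E"
proof -
  obtain f where f: "rational_function G f" "Poly_Mapping.lookup (D - E) = div_of G f"
    using assms unfolding lin_equiv_def by blast
  have "div_degree (D - E) = (\<Sum>p\<in>Poly_Mapping.keys (D - E). div_of G f p)"
    unfolding div_degree_def f(2) ..
  also have "\<dots> = 0"
    by (intro sum_div_of f(1)) (auto simp: in_keys_iff f(2))
  finally show ?thesis by (simp add: div_degree_diff)
qed

text \<open>The divisor \<open>D + div f\<close>.\<close>

definition plus_div :: "('a point \<Rightarrow>\<^sub>0 int) \<Rightarrow> ('a point \<Rightarrow> real) \<Rightarrow> 'a point \<Rightarrow>\<^sub>0 int" where
  "plus_div D f = Abs_poly_mapping (\<lambda>p. Poly_Mapping.lookup D p + div_of G f p)"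

lemma lookup_plus_div:
  assumes "rational_function G f"
  shows "Poly_Mapping.lookup (plus_div D f) p = Poly_Mapping.lookup D p + div_of G f p"
proof -
  have "{p. Poly_Mapping.lookup D p + div_of G f p \<noteq> 0} \<subseteq>
    Poly_Mapping.keys D \<union> {p. div_of G f p \<noteq> 0}" by (auto simp: in_keys_iff)
  then have "finite {p. Poly_Mapping.lookup D p + div_of G f p \<noteq> 0}"
    by (rule finite_subset) (use finite_div_support[OF assms] in simp)
  then show ?thesis unfolding plus_div_def by simp
qed

lemma lin_equiv_plus_div:
  assumes "rational_function G f"
  shows "lin_equiv G (plus_div D f) D"
  unfolding lin_equiv_def using assms
  by (intro exI[of _ f]) (auto simp: lookup_minus lookup_plus_div fun_eq_iff)

lemma divisor_on_plus_div:
  assumes "rational_function G f" "divisor_on G D"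
  shows "divisor_on G (plus_div D f)"
  using assms div_of_outside[of _ f] unfolding divisor_on_def
  by (auto simp: in_keys_iff lookup_plus_div) (metis add.right_neutral in_keys_iff subsetD)

lemma degree_plus_div: "rational_function G f \<Longrightarrow> div_degree (plus_div D f) = div_degree D"
  using lin_equiv_degree[OF lin_equiv_plus_div] .

text \<open>Membership of \<open>f\<close> in the tropical module of \<open>D\<close>, consisting of the rational functions with
  \<open>D + div f \<ge> 0\<close>.\<close>

definition admissible :: "('a point \<Rightarrow>\<^sub>0 int) \<Rightarrow> ('a point \<Rightarrow> real) \<Rightarrow> bool" where
  "admissible D f \<longleftrightarrow> rational_function G f \<and> (\<forall>p. 0 \<le> Poly_Mapping.lookup D p + div_of G f p)"

lemma admissible_rational: "admissible D f \<Longrightarrow> rational_function G f"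
  by (simp add: admissible_def)

lemma admissible_effective: "admissible D f \<Longrightarrow> effective (plus_div D f)"
  by (simp add: admissible_def effective_def lookup_plus_div)

lemma admissible_max_const:
  assumes "admissible D f" "effective D"
  shows "admissible D (\<lambda>p. max (f p) c)"
  unfolding admissible_def
proof (intro conjI allI)
  show "rational_function G (\<lambda>p. max (f p) c)"
    using assms by (intro rational_max_const admissible_rational)
  fix p
  have "0 \<le> Poly_Mapping.lookup D p + div_of G f p" "0 \<le> Poly_Mapping.lookup D p"
    using assms by (auto simp: admissible_def effective_def)
  then show "0 \<le> Poly_Mapping.lookup D p + div_of G (\<lambda>p. max (f p) c) p"
    using div_of_max_const[OF admissible_rational[OF assms(1)], where p = p and c = c] by (cases "f p < c") auto
qed

lemma linear_system_iff:
  assumes "divisor_on G D"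
  shows "linear_system G D \<noteq> {} \<longleftrightarrow> (\<exists>f. admissible D f)"
proof
  assume "linear_system G D \<noteq> {}"
  then obtain E f where E: "effective E" "rational_function G f"
    "Poly_Mapping.lookup (E - D) = div_of G f"
    unfolding linear_system_def lin_equiv_def by blast
  have "Poly_Mapping.lookup D p + div_of G f p = Poly_Mapping.lookup E p" for p
    using fun_cong[OF E(3), of p] by (simp add: lookup_minus)
  with E show "\<exists>f. admissible D f" unfolding admissible_def effective_def by auto
next
  assume "\<exists>f. admissible D f"
  then obtain f where "admissible D f" by blast
  then have "plus_div D f \<in> linear_system G D"
    unfolding linear_system_def
    using assms by (auto simp: divisor_on_plus_div lin_equiv_plus_div admissible_effective
        admissible_rational)
  then show "linear_system G D \<noteq> {}" by blast
qed

section \<open>Level sets of admissible functions\<close>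

text \<open>Near the branch \<open>f\<close> is affine; cut off at one of the values it takes there, it acquires a
  kink whose multiplicity is the absolute value of the slope.\<close>

lemma slope_bound:
  assumes "admissible D f" "effective D" "adj u v" "0 \<le> t" "t < elen u v"
  shows "\<bar>slope f u v t\<bar> \<le> div_degree D"
proof -
  define m where "m = slope f u v t"
  note rat = admissible_rational[OF assms(1)]
  obtain e where e: "0 < e"
    "\<And>s. 0 \<le> s \<Longrightarrow> s \<le> e \<Longrightarrow> f (ep u v (t + s)) = f (ep u v t) + of_int m * s"
    using rational_rgerm[OF rat assms(3-5)] unfolding m_def by (rule rgermE) blast
  define y where "y = min (t + e) (elen u v)"
  have y: "t < y" "y \<le> t + e" "y \<le> elen u v" using e(1) assms(5) by (auto simp: y_def)
  have lin: "f (ep u v s) = f (ep u v t) + of_int m * (s - t)" if "s \<in> {t..y}" for s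
    using e(2)[of "s - t"] that y by auto
  define z where "z = (t + y) / 2"
  have z: "t < z" "z < y" "0 < z" "z < elen u v" using y assms(4) by (auto simp: z_def)
  have m1: "slope f u v z = m"
    by (rule slope_eqI[OF rgerm_linear[OF _ z(2) lin]]) (use z in auto)
  have m2: "slope f v u (elen u v - z) = - m"
    using rgerm_linear_rev[OF z(1) less_imp_le[OF z(2)] lin, of "elen u v"]
    by (intro slope_eqI) (simp add: ep_reverse[OF assms(3)])
  define c where "c = f (ep u v z)"
  have rev: "ep v u (elen u v - z) = ep u v z"
    using ep_reverse[of v u z] adjD[OF assms(3)] by simp
  have "div_of G (\<lambda>p. max (f p) c) (ep u v z) = max m 0 + max (- m) 0"
    using z rat assms(3) adjD[OF assms(3)]
    by (simp add: div_of_interior slope_max_const rev m1 m2) (simp add: c_def)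
  then have "\<bar>m\<bar> \<le> Poly_Mapping.lookup (plus_div D (\<lambda>p. max (f p) c)) (ep u v z)"
    using assms(2)[unfolded effective_def, rule_format, of "ep u v z"]
    by (simp add: lookup_plus_div rational_max_const rat)
  also have "\<dots> \<le> div_degree (plus_div D (\<lambda>p. max (f p) c))"
    by (intro lookup_le_degree admissible_effective admissible_max_const assms)
  also have "\<dots> = div_degree D"
    by (intro degree_plus_div rational_max_const rat)
  finally show ?thesis unfolding m_def .
qed

lemma rational_continuous_edge:
  "rational_function G f \<Longrightarrow> adj u v \<Longrightarrow> continuous_on {0..elen u v} (\<lambda>t. f (ep u v t))"
  using pl_int_slopes_continuous[OF rational_pl] adjD by blast

text \<open>If \<open>f\<close> is maximal at \<open>u\<close> along the edge to \<open>v\<close> and smaller at \<open>v\<close>, then the last point \<open>t\<close>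
  where the maximum is attained has a negative slope towards \<open>v\<close> and no positive slope towards \<open>u\<close>.\<close>

lemma leave_max:
  assumes "rational_function G f" "adj u v"
    and max: "\<And>t. 0 \<le> t \<Longrightarrow> t \<le> elen u v \<Longrightarrow> f (ep u v t) \<le> f (vertex_point u)"
    and less: "f (vertex_point v) < f (vertex_point u)"
  obtains t where "0 \<le> t" "t < elen u v" "f (ep u v t) = f (vertex_point u)" "slope f u v t < 0"
    "0 < t \<Longrightarrow> slope f v u (elen u v - t) \<le> 0"
proof -
  define M where "M = f (vertex_point u)"
  define A where "A = {t \<in> {0..elen u v}. f (ep u v t) = M}"
  have "closed A" unfolding A_def
    by (intro continuous_closed_preimage_constant rational_continuous_edge assms closed_atLeastAtMost)
  then have "compact A"
    by (intro compact_eq_bounded_closed[THEN iffD2] conjI bounded_subset[OF bounded_closed_interval])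
      (auto simp: A_def)
  moreover have "0 \<in> A" using adjD[OF assms(2)] by (auto simp: A_def M_def ep_start assms(2))
  ultimately obtain t where t: "t \<in> A" "\<And>s. s \<in> A \<Longrightarrow> s \<le> t"
    using compact_attains_sup[of A] by blast
  have "t \<noteq> elen u v" using t(1) less by (auto simp: A_def M_def ep_end[OF assms(2)])
  then have t': "0 \<le> t" "t < elen u v" "f (ep u v t) = M" using t(1) by (auto simp: A_def)
  have germ: "rgerm (\<lambda>s. f (ep u v s)) t (slope f u v t)"
    using rational_rgerm assms t' by blast
  have "slope f u v t \<le> 0"
    by (rule rgerm_bound_above[OF germ, of "elen u v - t"])
      (use t' max in \<open>auto simp: M_def\<close>)
  moreover have "slope f u v t \<noteq> 0"
  proof
    assume "slope f u v t = 0"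
    with germ obtain e where e: "0 < e" "\<And>s. 0 \<le> s \<Longrightarrow> s \<le> e \<Longrightarrow> f (ep u v (t + s)) = M"
      using t'(3) by (auto elim!: rgermE)
    define s where "s = min e (elen u v - t)"
    have "t + s \<in> A" using e t' by (auto simp: A_def s_def)
    moreover have "0 < s" using e t' by (auto simp: s_def)
    ultimately show False using t(2) by fastforce
  qed
  moreover have "slope f v u (elen u v - t) \<le> 0" if "0 < t"
  proof (rule rgerm_bound_above)
    show "rgerm (\<lambda>s. f (ep u v (elen u v - s))) (elen u v - t) (slope f v u (elen u v - t))"
      using rational_rgerm_rev assms that t' by (meson less_imp_le)
    show "0 < t" by (rule that)
    fix s assume "0 < s" "s < t"
    then show "f (ep u v (elen u v - (elen u v - t + s)))
      \<le> f (ep u v (elen u v - (elen u v - t))) + real_of_int 0 * s"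
      using max[of "t - s"] t' by (auto simp: M_def)
  qed
  ultimately show thesis using that[of t] t' unfolding M_def by force
qed

text \<open>Cut off below at \<open>c\<close>, the function turns upwards in the interior of every edge that crosses the
  level \<open>c\<close>, so \<open>D + div (max f c)\<close> has a chip in the interior of each of these edges.\<close>

lemma card_cut_le_degree:
  assumes "admissible D f" "effective D"
    and c: "\<And>v. v \<in> verts G \<Longrightarrow> f (vertex_point v) \<noteq> c"
  shows "int (card {{u, v} | u v. adj u v \<and> f (vertex_point u) < c \<and> c < f (vertex_point v)})
    \<le> div_degree D"
proof -
  define g where "g = (\<lambda>p. max (f p) c)"
  note rat = admissible_rational[OF assms(1)]
  have ratg: "rational_function G g" unfolding g_def by (rule rational_max_const[OF rat])
  have eff: "effective (plus_div D g)"
    unfolding g_def by (intro admissible_effective admissible_max_const assms)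
  have "int (card {{u, v} | u v. adj u v \<and> f (vertex_point u) < c \<and> c < f (vertex_point v)})
    \<le> div_degree (plus_div D g)"
    using eff
  proof (rule card_supports_le_degree, safe)
    fix u v assume a: "adj u v" and u: "f (vertex_point u) < c" and v: "c < f (vertex_point v)"
    have rat': "rational_function G (\<lambda>p. - g p)" by (rule rational_uminus[OF ratg])
    obtain t where t: "0 \<le> t" "t < elen u v" "- g (ep u v t) = - g (vertex_point u)"
      "slope (\<lambda>p. - g p) u v t < 0" "0 < t \<Longrightarrow> slope (\<lambda>p. - g p) v u (elen u v - t) \<le> 0"
    proof (rule leave_max[OF rat' a])
      show "- g (ep u v t) \<le> - g (vertex_point u)" for t
        using u by (simp add: g_def)
      show "- g (vertex_point v) < - g (vertex_point u)"
        using u v by (simp add: g_def)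
    qed blast
    have "t \<noteq> 0"
    proof
      assume "t = 0"
      moreover have "slope g u v 0 = 0"
        unfolding g_def using adjD[OF a] u by (simp add: slope_max_const[OF rat a] ep_start[OF a])
      ultimately show False using t(4) adjD[OF a] by (simp add: slope_uminus[OF ratg a])
    qed
    with t have t': "0 < t" by simp
    have "div_of G g (ep u v t) > 0"
      using t(4) t(5)[OF t'] t(1,2) t' adjD[OF a] a
      by (simp add: div_of_interior slope_uminus ratg)
    then have "ep u v t \<in> Poly_Mapping.keys (plus_div D g)"
      using assms(2) by (simp add: in_keys_iff lookup_plus_div ratg effective_def)
        (smt (verit))
    moreover have "{w. ep u v t w \<noteq> 0} = {u, v}" by (rule ep_support[OF a t' t(2)])
    ultimately show "{u, v} \<in> (\<lambda>p. {w. p w \<noteq> 0}) ` Poly_Mapping.keys (plus_div D g)"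
      by (intro image_eqI[of _ _ "ep u v t"]) simp_all
  qed
  then show ?thesis by (simp add: degree_plus_div[OF ratg])
qed

end

section \<open>Suprema of convex functions with integer slopes\<close>

lemma pl_int_slopes_lipschitz:
  assumes "pl_int_slopes 0 L g"
    and r: "\<And>t. 0 \<le> t \<Longrightarrow> t < L \<Longrightarrow> rgerm g t (r t)"
    and N: "\<And>t. 0 \<le> t \<Longrightarrow> t < L \<Longrightarrow> r t \<le> N"
    and xy: "0 \<le> x" "x < y" "y \<le> L"
  shows "g y \<le> g x + of_int N * (y - x)"
  using pl_int_slopes_subinterval[OF assms(1) xy] xy(2)
proof (induction rule: pl_int_slopes_induct[where P = "\<lambda>x y. g y \<le> g x + of_int N * (y - x)"])
  case (linear x' y' m)
  have "r x' = m"
    using r[of x'] linear(1-3) xy by (intro rgerm_unique[OF _ rgerm_linear[OF _ _ linear(4)]]) auto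
  moreover have "r x' \<le> N" using N[of x'] linear(1-3) xy by auto
  ultimately have "of_int m * (y' - x') \<le> of_int N * (y' - x')"
    using linear(1-3) by (intro mult_right_mono) auto
  moreover have "g y' = g x' + of_int m * (y' - x')"
    using linear(1-3) by (intro linear(4)) auto
  ultimately show ?case by simp
next
  case (concat x y z)
  then show ?case by (simp add: algebra_simps)
qed

lemma rgerm_kink: "rgerm (\<lambda>s. max 0 (s - \<tau>)) t (if \<tau> \<le> t then 1 else 0)"
proof -
  have "rgerm (\<lambda>s. max 0 (- \<tau> + of_int 1 * s)) t
    (if 0 > - \<tau> + of_int 1 * t then 0 else if 0 < - \<tau> + of_int 1 * t then 1 else max 0 1)"
    by (intro rgerm_max rgerm_const rgerm_affine)
  then show ?thesis by (auto split: if_splits)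
qed

lemma rgerm_kink_rev: "rgerm (\<lambda>s. max 0 (L - s - \<tau>)) (L - t) (if \<tau> < t then - 1 else 0)"
proof -
  have "rgerm (\<lambda>s. max 0 (L - \<tau> + of_int (- 1) * s)) (L - t)
    (if 0 > L - \<tau> + of_int (- 1) * (L - t) then 0
     else if 0 < L - \<tau> + of_int (- 1) * (L - t) then - 1 else max 0 (- 1))"
    by (intro rgerm_max rgerm_const rgerm_affine)
  moreover have "(\<lambda>s. max 0 (L - \<tau> + of_int (- 1) * s)) = (\<lambda>s. max 0 (L - s - \<tau>))"
    by (auto simp: algebra_simps)
  ultimately show ?thesis by (auto split: if_splits)
qed

text \<open>The function \<open>h\<close> on \<open>[0, L]\<close> has a supporting line at every point whose slope is an integer of
  absolute value at most \<open>K\<close>. For a function with integer slopes bounded by \<open>K\<close> this means convexity;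
  unlike piecewise linearity it is visibly inherited by pointwise suprema.\<close>

definition int_subgradients :: "real \<Rightarrow> int \<Rightarrow> (real \<Rightarrow> real) \<Rightarrow> bool" where
  "int_subgradients L K h \<longleftrightarrow>
    (\<forall>t\<in>{0..L}. \<exists>k. \<bar>k\<bar> \<le> K \<and> (\<forall>s\<in>{0..L}. h t + of_int k * (s - t) \<le> h s))"

text \<open>Only finitely many slopes \<open>k\<close> are possible. If each of them failed to be a subgradient of the
  supremum \<open>h\<close> at \<open>t\<close>, then all would fail by a common margin \<open>e\<close>, contradicting the existence of a
  member of the family that comes within \<open>e\<close> of \<open>h t\<close>.\<close>

lemma int_subgradients_sup:
  assumes sub: "\<And>i. i \<in> I \<Longrightarrow> int_subgradients L K (\<phi> i)"
    and le: "\<And>i s. i \<in> I \<Longrightarrow> s \<in> {0..L} \<Longrightarrow> \<phi> i s \<le> h s"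
    and approx: "\<And>t e. t \<in> {0..L} \<Longrightarrow> 0 < e \<Longrightarrow> \<exists>i\<in>I. h t - e < \<phi> i t"
  shows "int_subgradients L K h"
  unfolding int_subgradients_def
proof (rule ballI, rule ccontr)
  fix t assume t: "t \<in> {0..L}"
  assume neg: "\<nexists>k. \<bar>k\<bar> \<le> K \<and> (\<forall>s\<in>{0..L}. h t + of_int k * (s - t) \<le> h s)"
  have "\<forall>k\<in>{-K..K}. \<exists>s. s \<in> {0..L} \<and> h s < h t + of_int k * (s - t)"
  proof
    fix k assume "k \<in> {-K..K}"
    then have "\<bar>k\<bar> \<le> K" by auto
    with neg have "\<not> (\<forall>s\<in>{0..L}. h t + of_int k * (s - t) \<le> h s)" by blast
    then show "\<exists>s. s \<in> {0..L} \<and> h s < h t + of_int k * (s - t)"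
      unfolding Ball_def not_all not_imp not_le .
  qed
  from bchoice[OF this] obtain \<sigma> where
    \<sigma>: "\<forall>k\<in>{-K..K}. \<sigma> k \<in> {0..L} \<and> h (\<sigma> k) < h t + of_int k * (\<sigma> k - t)" by blast
  have ex_e: "\<exists>e>0. \<forall>k\<in>A. e \<le> h t + of_int k * (\<sigma> k - t) - h (\<sigma> k)"
    if "finite A" "A \<subseteq> {-K..K}" for A
    using that
  proof (induction A)
    case (insert k A)
    then obtain e where "e > 0" "\<forall>k\<in>A. e \<le> h t + of_int k * (\<sigma> k - t) - h (\<sigma> k)" by auto
    with insert.prems \<sigma> show ?case
      by (intro exI[of _ "min e (h t + of_int k * (\<sigma> k - t) - h (\<sigma> k))"]) auto
  qed (auto intro: zero_less_one)
  obtain e where e: "e > 0" "\<forall>k\<in>{-K..K}. e \<le> h t + of_int k * (\<sigma> k - t) - h (\<sigma> k)"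
    using ex_e[of "{-K..K}"] by auto
  obtain i where i: "i \<in> I" "h t - e < \<phi> i t" using approx[OF t e(1)] by blast
  obtain k where k: "\<bar>k\<bar> \<le> K" "\<forall>s\<in>{0..L}. \<phi> i t + of_int k * (s - t) \<le> \<phi> i s"
    using sub[OF i(1)] t unfolding int_subgradients_def by blast
  from k(1) have kK: "k \<in> {-K..K}" by auto
  with \<sigma> have s: "\<sigma> k \<in> {0..L}" by blast
  have "\<phi> i t + of_int k * (\<sigma> k - t) \<le> h (\<sigma> k)"
    using le[OF i(1) s] bspec[OF k(2) s] by linarith
  with bspec[OF e(2) kK] i(2) show False by linarith
qed

lemma rgerm_Max:
  assumes "finite A" "A \<noteq> {}" "\<And>a. a \<in> A \<Longrightarrow> \<exists>m. rgerm (\<phi> a) t m"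
  shows "\<exists>m. rgerm (\<lambda>s. Max ((\<lambda>a. \<phi> a s) ` A)) t m"
  using assms
proof (induction A rule: finite_ne_induct)
  case (insert a A)
  from insert.prems obtain m where m: "rgerm (\<phi> a) t m" by blast
  from insert obtain k where k: "rgerm (\<lambda>s. Max ((\<lambda>a. \<phi> a s) ` A)) t k" by blast
  have "Max ((\<lambda>a. \<phi> a s) ` insert a A) = max (\<phi> a s) (Max ((\<lambda>a. \<phi> a s) ` A))" for s
    using insert.hyps by simp
  with rgerm_max[OF m k] show ?case by auto
qed auto

text \<open>Such a function is the maximum of the finitely many lines \<open>c k + k s\<close>, where \<open>- c\<close> is its Legendre
  transform.\<close>

lemma int_subgradients_rgerm:
  assumes "int_subgradients L K h" "0 \<le> t" "t < L"
  shows "\<exists>m. rgerm h t m"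
proof -
  define c where "c k = (INF s\<in>{0..L}. h s - of_int k * s)" for k :: int
  have sub: "\<exists>k\<in>{-K..K}. \<forall>s\<in>{0..L}. h t + of_int k * (s - t) \<le> h s" if "t \<in> {0..L}" for t
    using assms(1) that unfolding int_subgradients_def by (fastforce simp: abs_le_iff)
  have "0 \<in> {0..L}" using assms by auto
  from sub[OF this] obtain k0 where k0: "k0 \<in> {-K..K}" "\<forall>s\<in>{0..L}. h 0 + of_int k0 * (s - 0) \<le> h s"
    by blast
  have bdd: "bdd_below ((\<lambda>s. h s - of_int k * s) ` {0..L})" for k :: int
  proof (rule bdd_belowI2)
    fix s assume s: "s \<in> {0..L}"
    have "(of_int k - of_int k0) * s \<le> \<bar>of_int k - of_int k0\<bar> * s"
      using s by (intro mult_right_mono) auto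
    also have "\<dots> \<le> \<bar>of_int k - of_int k0\<bar> * L"
      using s by (intro mult_left_mono) auto
    finally have "of_int k * s - of_int k0 * s \<le> \<bar>of_int k - of_int k0\<bar> * L"
      by (simp only: left_diff_distrib)
    with bspec[OF k0(2) s] show "h 0 - \<bar>of_int k - of_int k0\<bar> * L \<le> h s - of_int k * s"
      by simp
  qed
  have h: "h s = Max ((\<lambda>k. c k + of_int k * s) ` {-K..K})" if s: "s \<in> {0..L}" for s
  proof (rule antisym)
    obtain k where k: "k \<in> {-K..K}" "\<forall>s'\<in>{0..L}. h s + of_int k * (s' - s) \<le> h s'"
      using sub[OF s] by blast
    have "h s - of_int k * s \<le> c k"
      unfolding c_def
    proof (rule cINF_greatest)
      fix s' assume "s' \<in> {0..L}"
      from bspec[OF k(2) this] show "h s - of_int k * s \<le> h s' - of_int k * s'"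
        by (simp add: algebra_simps)
    qed (use s in auto)
    then have "h s \<le> c k + of_int k * s" by simp
    also have "\<dots> \<le> Max ((\<lambda>k. c k + of_int k * s) ` {-K..K})"
      using k(1) by (intro Max_ge) auto
    finally show "h s \<le> Max ((\<lambda>k. c k + of_int k * s) ` {-K..K})" .
    have "c k + of_int k * s \<le> h s" for k
      using cINF_lower[OF bdd s, of k] unfolding c_def by simp
    then show "Max ((\<lambda>k. c k + of_int k * s) ` {-K..K}) \<le> h s"
      using k(1) by (intro Max.boundedI) auto
  qed
  obtain m where m: "rgerm (\<lambda>s. Max ((\<lambda>k. c k + of_int k * s) ` {-K..K})) t m"
    using rgerm_Max[of "{-K..K}" "\<lambda>k s. c k + of_int k * s" t] rgerm_affine k0(1) by fastforce
  have "rgerm h t m"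
    by (rule rgerm_cong[OF m, of "L - t"]) (use assms h in auto)
  then show ?thesis ..
qed

context metric_graph
begin

section \<open>Existence of reduced divisors\<close>

text \<open>For effective \<open>D\<close>, a convex function along the edge from \<open>u\<close> to \<open>v\<close> whose slope jumps by the multiplicity of
  \<open>D\<close> at every chip in the interior of the edge. If \<open>D + div f \<ge> 0\<close>, then \<open>f + chip_corr\<close> is convex along
  the whole edge. The function vanishes near \<open>u\<close>, so it does not affect slopes at \<open>u\<close>.\<close>

definition chip_corr :: "('a point \<Rightarrow>\<^sub>0 int) \<Rightarrow> 'a \<Rightarrow> 'a \<Rightarrow> real \<Rightarrow> real" where
  "chip_corr D u v t =
    (\<Sum>\<tau> | 0 < \<tau> \<and> \<tau> < elen u v \<and> ep u v \<tau> \<in> Poly_Mapping.keys D.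
      of_int (Poly_Mapping.lookup D (ep u v \<tau>)) * max 0 (t - \<tau>))"

lemma finite_chips:
  assumes "adj u v"
  shows "finite {\<tau>. 0 < \<tau> \<and> \<tau> < elen u v \<and> ep u v \<tau> \<in> Poly_Mapping.keys D}"
    (is "finite ?T")
proof (rule finite_imageD)
  show "finite (ep u v ` ?T)"
    by (rule finite_subset[of _ "Poly_Mapping.keys D"]) auto
  show "inj_on (ep u v) ?T" using ep_inj[OF assms] by (auto intro: inj_onI)
qed

text \<open>The slopes \<open>rp t\<close> towards \<open>v\<close> and \<open>lp t\<close> towards \<open>u\<close>, and a common bound for them.\<close>

lemma chip_corr_germs:
  assumes "adj u v"
  obtains rp lp K where
    "\<And>t. rgerm (chip_corr D u v) t (rp t)"
    "\<And>t. rgerm (\<lambda>s. chip_corr D u v (elen u v - s)) (elen u v - t) (lp t)"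
    "\<And>t. 0 < t \<Longrightarrow> t < elen u v \<Longrightarrow> rp t + lp t = Poly_Mapping.lookup D (ep u v t)"
    "rp 0 = 0" "\<And>t. \<bar>rp t\<bar> \<le> K" "\<And>t. \<bar>lp t\<bar> \<le> K" "chip_corr D u v 0 = 0"
proof -
  define T where "T = {\<tau>. 0 < \<tau> \<and> \<tau> < elen u v \<and> ep u v \<tau> \<in> Poly_Mapping.keys D}"
  have fin: "finite T" unfolding T_def by (rule finite_chips[OF assms])
  define d where "d \<tau> = Poly_Mapping.lookup D (ep u v \<tau>)" for \<tau>
  define rp where "rp t = (\<Sum>\<tau>\<in>T. d \<tau> * (if \<tau> \<le> t then 1 else 0))" for t
  define lp where "lp t = (\<Sum>\<tau>\<in>T. d \<tau> * (if \<tau> < t then - 1 else 0))" for t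
  have corr: "chip_corr D u v = (\<lambda>t. \<Sum>\<tau>\<in>T. of_int (d \<tau>) * max 0 (t - \<tau>))"
    by (simp add: chip_corr_def T_def d_def fun_eq_iff)
  show thesis
  proof (rule that[of rp lp "\<Sum>\<tau>\<in>T. \<bar>d \<tau>\<bar>"])
    show "rgerm (chip_corr D u v) t (rp t)" for t
      unfolding corr rp_def by (intro rgerm_sum fin rgerm_mult rgerm_kink)
    show "rgerm (\<lambda>s. chip_corr D u v (elen u v - s)) (elen u v - t) (lp t)" for t
      unfolding corr lp_def by (intro rgerm_sum fin rgerm_mult rgerm_kink_rev)
    show "rp t + lp t = Poly_Mapping.lookup D (ep u v t)" if "0 < t" "t < elen u v" for t
    proof -
      have "rp t + lp t = (\<Sum>\<tau>\<in>T. if \<tau> = t then d \<tau> else 0)"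
        unfolding rp_def lp_def sum.distrib[symmetric] by (intro sum.cong) auto
      also have "\<dots> = d t"
        using fin that by (auto simp: T_def d_def in_keys_iff)
      finally show ?thesis unfolding d_def .
    qed
    show "rp 0 = 0" unfolding rp_def by (rule sum.neutral) (auto simp: T_def)
    show "\<bar>rp t\<bar> \<le> (\<Sum>\<tau>\<in>T. \<bar>d \<tau>\<bar>)" for t
      unfolding rp_def by (intro order_trans[OF sum_abs] sum_mono) auto
    show "\<bar>lp t\<bar> \<le> (\<Sum>\<tau>\<in>T. \<bar>d \<tau>\<bar>)" for t
      unfolding lp_def by (intro order_trans[OF sum_abs] sum_mono) auto
    show "chip_corr D u v 0 = 0"
      unfolding corr by (rule sum.neutral) (auto simp: T_def)
  qed
qed

lemma admissible_subgradients:
  assumes "effective D" "adj u v"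
  shows "\<exists>K. \<forall>f. admissible D f \<longrightarrow>
    int_subgradients (elen u v) K (\<lambda>t. f (ep u v t) + chip_corr D u v t)"
    and "\<lbrakk>admissible D f; 0 \<le> s; s \<le> elen u v\<rbrakk> \<Longrightarrow>
      f (vertex_point u) + of_int (slope f u v 0) * s \<le> f (ep u v s) + chip_corr D u v s"
proof -
  let ?L = "elen u v"
  obtain rp lp K where p:
    "\<And>t. rgerm (chip_corr D u v) t (rp t)"
    "\<And>t. rgerm (\<lambda>s. chip_corr D u v (elen u v - s)) (elen u v - t) (lp t)"
    "\<And>t. 0 < t \<Longrightarrow> t < elen u v \<Longrightarrow> rp t + lp t = Poly_Mapping.lookup D (ep u v t)"
    "rp 0 = 0" "\<And>t. \<bar>rp t\<bar> \<le> K" "\<And>t. \<bar>lp t\<bar> \<le> K" "chip_corr D u v 0 = 0"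
    using chip_corr_germs[OF assms(2), of D] by metis
  have main: "(\<forall>t. 0 \<le> t \<and> t < ?L \<longrightarrow> (\<forall>s\<in>{0..?L}.
      f (ep u v t) + chip_corr D u v t + of_int (slope f u v t + rp t) * (s - t)
        \<le> f (ep u v s) + chip_corr D u v s)) \<and>
    (\<forall>s\<in>{0..?L}. f (ep u v ?L) + chip_corr D u v ?L + of_int (- (slope f v u 0 + lp ?L)) * (s - ?L)
        \<le> f (ep u v s) + chip_corr D u v s)" if f: "admissible D f" for f
  proof -
    note rat = admissible_rational[OF f]
    define g where "g = (\<lambda>t. f (ep u v t) + chip_corr D u v t)"
    define r where "r t = slope f u v t + rp t" for t
    define l where "l t = slope f v u (?L - t) + lp t" for t
    have r: "rgerm g t (r t)" if "0 \<le> t" "t < ?L" for t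
      unfolding g_def r_def by (intro rgerm_add rational_rgerm rat assms that p)
    have l: "rgerm (\<lambda>s. g (?L - s)) (?L - t) (l t)" if "0 < t" "t \<le> ?L" for t
      unfolding g_def l_def by (intro rgerm_add rational_rgerm_rev rat assms that p)
    have L: "0 < ?L" using adjD assms by blast
    have pl: "pl_int_slopes 0 ?L g"
    proof (rule pl_int_slopes_rgermI[OF L])
      fix t assume "0 \<le> t" "t < ?L"
      then show "\<exists>m. rgerm g t m" "\<exists>m. rgerm (\<lambda>s. g (?L - s)) t m"
        using r[of t] l[of "?L - t"] by auto
    qed
    have rl: "0 \<le> r t + l t" if "0 < t" "t < ?L" for t
      using f p(3)[OF that] div_of_interior[OF assms(2) that, of f]
      unfolding admissible_def r_def l_def by (smt (verit))
    note conv = convex_slopes[OF pl L r l rl]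
    show ?thesis
      unfolding g_def[symmetric]
    proof (intro conjI allI impI ballI)
      fix t s assume t: "0 \<le> t \<and> t < ?L" and s: "s \<in> {0..?L}"
      consider "s = t" | "t < s" | "s < t" by linarith
      then have "g t + of_int (r t) * (s - t) \<le> g s"
      proof cases
        case 2
        then show ?thesis using conv(2)[of t s] t s by auto
      next
        case 3
        have "of_int (- l t) * (t - s) \<le> of_int (r t) * (t - s)"
          using rl[of t] 3 t s by (intro mult_right_mono) auto
        moreover have "g t + of_int (l t) * (t - s) \<le> g s" using conv(3)[of s t] 3 t s by auto
        ultimately show ?thesis by (simp add: algebra_simps)
      qed auto
      then show "f (ep u v t) + chip_corr D u v t + of_int (slope f u v t + rp t) * (s - t)
        \<le> f (ep u v s) + chip_corr D u v s" by (simp add: g_def r_def)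
    next
      fix s assume s: "s \<in> {0..?L}"
      have "g ?L + of_int (l ?L) * (?L - s) \<le> g s"
        using conv(3)[of s ?L] s by (cases "s = ?L") auto
      then show "f (ep u v ?L) + chip_corr D u v ?L + of_int (- (slope f v u 0 + lp ?L)) * (s - ?L)
        \<le> f (ep u v s) + chip_corr D u v s" by (simp add: g_def l_def algebra_simps)
    qed
  qed
  show "\<exists>K. \<forall>f. admissible D f \<longrightarrow>
    int_subgradients ?L K (\<lambda>t. f (ep u v t) + chip_corr D u v t)"
  proof (intro exI[of _ "div_degree D + K"] allI impI)
    fix f assume f: "admissible D f"
    show "int_subgradients ?L (div_degree D + K) (\<lambda>t. f (ep u v t) + chip_corr D u v t)"
      unfolding int_subgradients_def
    proof
      fix t assume t: "t \<in> {0..?L}"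
      show "\<exists>k. \<bar>k\<bar> \<le> div_degree D + K \<and> (\<forall>s\<in>{0..?L}.
        f (ep u v t) + chip_corr D u v t + of_int k * (s - t) \<le> f (ep u v s) + chip_corr D u v s)"
      proof (cases "t = ?L")
        case True
        have "\<bar>slope f v u 0\<bar> \<le> div_degree D"
          using slope_bound[OF f assms(1), of v u 0] adjD[OF assms(2)] by simp
        then have "\<bar>- (slope f v u 0 + lp ?L)\<bar> \<le> div_degree D + K"
          using p(6)[of ?L] by linarith
        with conjunct2[OF main[OF f]] True show ?thesis by blast
      next
        case False
        have "\<bar>slope f u v t\<bar> \<le> div_degree D"
          using slope_bound[OF f assms, of t] t False by simp
        then have "\<bar>slope f u v t + rp t\<bar> \<le> div_degree D + K"
          using p(5)[of t] by linarith
        moreover have "\<forall>s\<in>{0..?L}. f (ep u v t) + chip_corr D u v t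
          + of_int (slope f u v t + rp t) * (s - t) \<le> f (ep u v s) + chip_corr D u v s"
          using conjunct1[OF main[OF f], rule_format, of t] t False by auto
        ultimately show ?thesis by blast
      qed
    qed
  qed
  show "f (vertex_point u) + of_int (slope f u v 0) * s \<le> f (ep u v s) + chip_corr D u v s"
    if "admissible D f" "0 \<le> s" "s \<le> ?L"
    using conjunct1[OF main[OF that(1)], rule_format, of 0 s] that adjD[OF assms(2)] p(4,7)
    by (simp add: ep_start[OF assms(2)])
qed

lemma admissible_edge_bound:
  assumes "admissible D f" "effective D" "adj u v" "0 \<le> t" "t \<le> elen u v"
  shows "f (ep u v t) \<le> f (vertex_point u) + of_int (div_degree D) * t"
proof (cases "t = 0")
  case False
  note rat = admissible_rational[OF assms(1)]
  have "f (ep u v t) \<le> f (ep u v 0) + of_int (div_degree D) * (t - 0)"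
  proof (rule pl_int_slopes_lipschitz[OF rational_pl[OF rat assms(3)]])
    show "rgerm (\<lambda>s. f (ep u v s)) t (slope f u v t)" if "0 \<le> t" "t < elen u v" for t
      using rational_rgerm[OF rat assms(3) that] .
    show "slope f u v t \<le> div_degree D" if "0 \<le> t" "t < elen u v" for t
      using slope_bound[OF assms(1-3) that] by simp
  qed (use assms False in auto)
  then show ?thesis by (simp add: ep_start[OF assms(3)])
qed (simp add: ep_start[OF assms(3)])

text \<open>The divisor \<open>D + div F\<close> is reduced with respect to \<open>v0\<close>: an effective divisor can be reached
  from it only by functions that are maximal at \<open>v0\<close>. Here \<open>F\<close> is the largest admissible function that
  vanishes at \<open>v0\<close>.\<close>

lemma reduced_divisor_exists:
  assumes "effective D" "divisor_on G D" "v0 \<in> verts G"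
    and conn: "\<And>u. u \<in> verts G \<Longrightarrow> (v0, u) \<in> {(u, v). adj u v}\<^sup>*"
  obtains F where "admissible D F"
    "\<And>g p. admissible (plus_div D F) g \<Longrightarrow> p \<in> points G \<Longrightarrow> g p \<le> g (vertex_point v0)"
proof -
  define R where "R = {f. admissible D f \<and> f (vertex_point v0) = 0}"
  have zero: "(\<lambda>p. 0) \<in> R"
    using assms(1) by (auto simp: R_def admissible_def rational_const div_of_const effective_def)
  \<comment> \<open>The supremum is finite since slopes are bounded by the degree and \<open>v0\<close> is joined to every vertex.\<close>
  have bv: "\<exists>M. \<forall>f\<in>R. f (vertex_point u) \<le> M" if "u \<in> verts G" for u
    using conn[OF that]
  proof (induction rule: rtrancl_induct)
    case base
    then show ?case by (intro exI[of _ 0]) (auto simp: R_def)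
  next
    case (step u v)
    then obtain M where M: "\<forall>f\<in>R. f (vertex_point u) \<le> M" and a: "adj u v" by auto
    show ?case
    proof (intro exI[of _ "M + of_int (div_degree D) * elen u v"] ballI)
      fix f assume f: "f \<in> R"
      then have "f (ep u v (elen u v)) \<le> f (vertex_point u) + of_int (div_degree D) * elen u v"
        using adjD[OF a] by (intro admissible_edge_bound assms a) (auto simp: R_def)
      with M f show "f (vertex_point v) \<le> M + of_int (div_degree D) * elen u v"
        by (fastforce simp: ep_end[OF a])
    qed
  qed
  have bp: "\<exists>M. \<forall>f\<in>R. f p \<le> M" if "p \<in> points G" for p
    using that
  proof (cases rule: point_cases)
    case (vertex u)
    then show ?thesis using bv by blast
  next
    case (interior u v t)
    from bv[of u] adjD[OF interior(1)] obtain M where M: "\<forall>f\<in>R. f (vertex_point u) \<le> M" by blast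
    show ?thesis
    proof (intro exI[of _ "M + of_int (div_degree D) * t"] ballI)
      fix f assume f: "f \<in> R"
      then have "f (ep u v t) \<le> f (vertex_point u) + of_int (div_degree D) * t"
        using interior by (intro admissible_edge_bound assms) (auto simp: R_def)
      with M f interior show "f p \<le> M + of_int (div_degree D) * t" by fastforce
    qed
  qed
  define F where "F p = (SUP f\<in>R. f p)" for p
  have le_F: "f p \<le> F p" if f: "f \<in> R" and p: "p \<in> points G" for f p
  proof -
    obtain M where "\<forall>f\<in>R. f p \<le> M" using bp[OF p] by blast
    then have "bdd_above ((\<lambda>f. f p) ` R)" by (auto intro: bdd_aboveI2)
    then show ?thesis unfolding F_def by (intro cSUP_upper f)
  qed
  have approx: "\<exists>f\<in>R. F p - e < f p" if "p \<in> points G" "0 < e" for p e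
  proof -
    have "F p - e < Sup ((\<lambda>f. f p) ` R)" using that(2) unfolding F_def by simp
    then show ?thesis using zero by (auto elim!: less_cSupE)
  qed
  have F0: "F (vertex_point v0) = 0"
  proof -
    have "(\<lambda>f. f (vertex_point v0)) ` R = {0}" using zero by (auto simp: R_def)
    then show ?thesis by (simp add: F_def)
  qed
  define h where "h u v t = F (ep u v t) + chip_corr D u v t" for u v t
  have sub: "\<exists>K. int_subgradients (elen u v) K (h u v)" if a: "adj u v" for u v
  proof -
    obtain K where K: "\<forall>f. admissible D f \<longrightarrow>
      int_subgradients (elen u v) K (\<lambda>t. f (ep u v t) + chip_corr D u v t)"
      using admissible_subgradients(1)[OF assms(1) a] by blast
    have "int_subgradients (elen u v) K (h u v)"
    proof (rule int_subgradients_sup[where I = R])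
      fix f s assume "f \<in> R" "s \<in> {0..elen u v}"
      then show "f (ep u v s) + chip_corr D u v s \<le> h u v s"
        using le_F[of f "ep u v s"] ep_in_points[OF a] by (auto simp: h_def)
    next
      fix t e :: real assume "t \<in> {0..elen u v}" "0 < e"
      then show "\<exists>f\<in>R. h u v t - e < f (ep u v t) + chip_corr D u v t"
        using approx[of "ep u v t" e] ep_in_points[OF a] by (force simp: h_def)
    qed (use K in \<open>auto simp: R_def\<close>)
    then show ?thesis ..
  qed
  have rat: "rational_function G F"
  proof (rule rational_functionI)
    fix u v t assume a: "adj u v" and t: "0 \<le> t" "t < elen u v"
    obtain m where m: "rgerm (h u v) t m"
      using sub[OF a] int_subgradients_rgerm t by blast
    obtain rp where "rgerm (chip_corr D u v) t rp" using chip_corr_germs[OF a, of D] by metis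
    from rgerm_diff[OF m this] show "\<exists>m. rgerm (\<lambda>s. F (ep u v s)) t m"
      by (auto simp: h_def)
  qed
  have "0 \<le> Poly_Mapping.lookup D p + div_of G F p" if "p \<in> points G" for p
    using that
  proof (cases rule: point_cases)
    case (interior u v t)
    note a = interior(1)
    obtain K where "int_subgradients (elen u v) K (h u v)" using sub[OF a] by blast
    then obtain k where k: "\<forall>s\<in>{0..elen u v}. h u v t + of_int k * (s - t) \<le> h u v s"
      using interior unfolding int_subgradients_def by (metis atLeastAtMost_iff less_imp_le)
    obtain rp lp where rl: "\<And>t. rgerm (chip_corr D u v) t (rp t)"
      "\<And>t. rgerm (\<lambda>s. chip_corr D u v (elen u v - s)) (elen u v - t) (lp t)"
      "\<And>t. 0 < t \<Longrightarrow> t < elen u v \<Longrightarrow> rp t + lp t = Poly_Mapping.lookup D (ep u v t)"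
      using chip_corr_germs[OF a, of D] by metis
    have "rgerm (h u v) t (slope F u v t + rp t)"
      unfolding h_def using interior by (intro rgerm_add rational_rgerm rat rl) auto
    then have "k \<le> slope F u v t + rp t"
    proof (rule rgerm_bound_below)
      fix s assume "0 < s" "s < elen u v - t"
      then show "h u v t + of_int k * s \<le> h u v (t + s)"
        using bspec[OF k, of "t + s"] interior by auto
    qed (use interior in auto)
    moreover have "rgerm (\<lambda>s. h u v (elen u v - s)) (elen u v - t)
      (slope F v u (elen u v - t) + lp t)"
      unfolding h_def using interior by (intro rgerm_add rational_rgerm_rev rat rl) auto
    then have "- k \<le> slope F v u (elen u v - t) + lp t"
    proof (rule rgerm_bound_below)
      fix s assume "0 < s" "s < t"
      then show "h u v (elen u v - (elen u v - t)) + of_int (- k) * s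
        \<le> h u v (elen u v - (elen u v - t + s))"
        using bspec[OF k, of "t - s"] interior by auto
    qed (use interior in auto)
    ultimately show ?thesis
      using rl(3)[of t] div_of_interior[of u v t F] interior by simp
  next
    case (vertex u)
    \<comment> \<open>Choose \<open>d\<close> so small that \<open>F\<close> is affine up to distance \<open>d\<close> from \<open>u\<close>. For an admissible \<open>f \<le> F\<close>
      with \<open>F u - d < f u\<close>, convexity bounds the slopes of \<open>f\<close> at \<open>u\<close> by those of \<open>F\<close> plus a number less
      than 1, hence by those of \<open>F\<close>.\<close>
    have ev: "\<forall>\<^sub>F s in at_right 0. 0 < s \<and> s \<le> elen u v \<and> chip_corr D u v s = 0 \<and>
      F (ep u v s) = F (vertex_point u) + of_int (slope F u v 0) * s" if a: "adj u v" for v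
    proof -
      obtain rp where rp: "rgerm (chip_corr D u v) 0 0" "chip_corr D u v 0 = 0"
        using chip_corr_germs[OF a, of D] by metis
      have 1: "\<forall>\<^sub>F s in at_right 0. F (ep u v (0 + s)) = F (ep u v 0) + of_int (slope F u v 0) * s"
        using rational_rgerm[OF rat a, of 0] adjD[OF a] unfolding rgerm_def by simp
      have 2: "\<forall>\<^sub>F s in at_right 0. chip_corr D u v (0 + s) = chip_corr D u v 0 + of_int 0 * s"
        using rp(1) unfolding rgerm_def .
      have 3: "\<forall>\<^sub>F s in at_right (0::real). 0 < s" by (rule eventually_at_right_less)
      have 4: "\<forall>\<^sub>F s in at_right 0. s < elen u v"
        using adjD[OF a] by (intro order_tendstoD(2)[OF tendsto_ident_at])
      from 1 2 3 4 show ?thesis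
        by eventually_elim (simp add: rp(2) ep_start[OF a])
    qed
    have "\<forall>\<^sub>F s in at_right 0. 0 < s \<and> (\<forall>v\<in>{v. adj u v}. 0 < s \<and> s \<le> elen u v \<and>
      chip_corr D u v s = 0 \<and> F (ep u v s) = F (vertex_point u) + of_int (slope F u v 0) * s)"
      using finite_nbrs ev
      by (intro eventually_conj eventually_ball_finite eventually_at_right_less) auto
    from eventually_happens'[OF trivial_limit_at_right_real this]
    obtain d where d': "0 < d \<and> (\<forall>v\<in>{v. adj u v}. 0 < d \<and> d \<le> elen u v \<and>
      chip_corr D u v d = 0 \<and> F (ep u v d) = F (vertex_point u) + of_int (slope F u v 0) * d)"
      by blast
    then have d: "0 < d" "\<And>v. adj u v \<Longrightarrow> d \<le> elen u v"
      "\<And>v. adj u v \<Longrightarrow> chip_corr D u v d = 0"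
      "\<And>v. adj u v \<Longrightarrow> F (ep u v d) = F (vertex_point u) + of_int (slope F u v 0) * d"
      by auto
    obtain f where f: "f \<in> R" "F (vertex_point u) - d < f (vertex_point u)"
      using approx[OF vertex_in_points[OF vertex(1)] d(1)] by blast
    have "slope f u v 0 \<le> slope F u v 0" if a: "adj u v" for v
    proof -
      have "f (vertex_point u) + of_int (slope f u v 0) * d \<le> f (ep u v d)"
        using admissible_subgradients(2)[OF assms(1) a, of f d] f(1) d(1) d(2,3)[OF a]
        by (simp add: R_def)
      also have "\<dots> \<le> F (ep u v d)"
        using d(1,2) a by (intro le_F f ep_in_points) auto
      also have "\<dots> < f (vertex_point u) + d + of_int (slope F u v 0) * d"
        using d(4)[OF a] f(2) by simp
      finally have "of_int (slope f u v 0) * d < of_int (slope F u v 0 + 1) * d"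
        by (simp add: algebra_simps)
      with d(1) have "slope f u v 0 < slope F u v 0 + 1"
        by (simp only: mult_less_cancel_right_pos of_int_less_iff)
      then show ?thesis by simp
    qed
    then have "div_of G f p \<le> div_of G F p"
      unfolding vertex(2) div_of_vertex by (intro sum_mono) auto
    moreover have "0 \<le> Poly_Mapping.lookup D p + div_of G f p"
      using f(1) by (auto simp: R_def admissible_def)
    ultimately show ?thesis by simp
  qed
  moreover have "0 \<le> Poly_Mapping.lookup D p + div_of G F p" if "p \<notin> points G" for p
    using that assms(1) by (simp add: div_of_outside effective_def)
  ultimately have adm: "admissible D F" unfolding admissible_def using rat by blast
  show thesis
  proof (rule that[OF adm])
    fix g p assume g: "admissible (plus_div D F) g" and p: "p \<in> points G"
    \<comment> \<open>Normalized at \<open>v0\<close>, the sum \<open>F + g\<close> is one of the functions of which \<open>F\<close> is the supremum.\<close>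
    define c where "c = g (vertex_point v0)"
    define f where "f = (\<lambda>p. F p + (g p + - c))"
    have ratg: "rational_function G g" using g by (rule admissible_rational)
    have rat_gc: "rational_function G (\<lambda>p. g p + - c)"
      by (rule rational_add[OF ratg rational_const])
    have "rational_function G f" unfolding f_def by (rule rational_add[OF rat rat_gc])
    moreover have "div_of G f p = div_of G F p + div_of G g p" for p
      unfolding f_def div_of_add[OF rat rat_gc] div_of_add[OF ratg rational_const] div_of_const
      by simp
    ultimately have "admissible D f"
      using g unfolding admissible_def by (simp add: lookup_plus_div rat add.assoc)
    then have "f \<in> R" by (simp add: R_def f_def F0 c_def)
    from le_F[OF this p] show "g p \<le> g (vertex_point v0)" by (simp add: f_def c_def)
  qed
qed

end

section \<open>The lower bound\<close>

text \<open>All pairs with one element in \<open>A\<close> and the other in \<open>V - A\<close>, whether or not they are edges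
  of the graph under consideration.\<close>

definition cut_edges :: "'a set \<Rightarrow> 'a set \<Rightarrow> 'a set set" where
  "cut_edges V A = (\<lambda>(u, v). {u, v}) ` (A \<times> (V - A))"

lemma card_cut_edges:
  assumes "finite V" "A \<subseteq> V"
  shows "card (cut_edges V A) = card A * (card V - card A)"
proof -
  have "inj_on (\<lambda>(u, v). {u, v}) (A \<times> (V - A))"
    by (auto simp: inj_on_def doubleton_eq_iff)
  then show ?thesis
    unfolding cut_edges_def using assms
    by (simp add: card_image card_cartesian_product card_Diff_subset finite_subset)
qed

lemma card_cut_edges_minus:
  assumes "finite V" "A \<subseteq> V" "finite F"
  shows "card A * (card V - card A) - card F \<le> card (cut_edges V A - F)"
  using diff_card_le_card_Diff[OF assms(3), of "cut_edges V A"] card_cut_edges[OF assms(1,2)] by simp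

lemma ex_vertex_in_few_edges:
  assumes "finite V" "F \<subseteq> [V]\<^bsup>2\<^esup>" "card F < card V"
  shows "\<exists>v\<in>V. card {e \<in> F. v \<in> e} \<le> 1"
proof (rule ccontr)
  assume "\<not> ?thesis"
  then have ge: "2 \<le> card {e \<in> F. v \<in> e}" if "v \<in> V" for v
    using that by force
  have fin: "finite F" using finite_imp_finite_nsets[OF assms(1)] assms(2) by (rule rev_finite_subset)
  have "2 * card V \<le> (\<Sum>v\<in>V. card {e \<in> F. v \<in> e})"
    using sum_mono[of V "\<lambda>_. 2" "\<lambda>v. card {e \<in> F. v \<in> e}"] ge by simp
  also have "\<dots> = (\<Sum>v\<in>V. \<Sum>e\<in>F. if v \<in> e then 1 else 0)"
    using fin by (simp add: sum.If_cases Int_def)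
  also have "\<dots> = (\<Sum>e\<in>F. \<Sum>v\<in>V. if v \<in> e then 1 else 0)" by (rule sum.swap)
  also have "\<dots> = (\<Sum>e\<in>F. 2)"
  proof (rule sum.cong[OF refl])
    fix e assume "e \<in> F"
    then have "e \<subseteq> V" "card e = 2" using assms(2) by (auto simp: nsets_def)
    then show "(\<Sum>v\<in>V. if v \<in> e then 1 else 0) = (2 :: nat)"
      using assms(1) by (simp add: sum.If_cases Int_absorb1)
  qed
  finally show False using assms(3) by simp
qed

lemma ex_independent_subset:
  assumes "finite E"
  obtains T where "T \<subseteq> S" "card S - card (E \<inter> [S]\<^bsup>2\<^esup>) \<le> card T" "E \<inter> [T]\<^bsup>2\<^esup> = {}"
proof -
  define R where "R = (\<lambda>e. SOME x. x \<in> e) ` (E \<inter> [S]\<^bsup>2\<^esup>)"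
  have fin: "finite R" "card R \<le> card (E \<inter> [S]\<^bsup>2\<^esup>)"
    unfolding R_def using assms by (auto intro: card_image_le)
  show thesis
  proof (rule that[of "S - R"])
    show "card S - card (E \<inter> [S]\<^bsup>2\<^esup>) \<le> card (S - R)"
      using diff_card_le_card_Diff[OF fin(1), of S] fin(2) by linarith
    show "E \<inter> [S - R]\<^bsup>2\<^esup> = {}"
    proof (rule equals0I)
      fix e assume e: "e \<in> E \<inter> [S - R]\<^bsup>2\<^esup>"
      then have "e \<noteq> {}" by (auto simp: nsets_def)
      then have "(SOME x. x \<in> e) \<in> e" by (simp add: some_in_eq)
      moreover have "e \<in> E \<inter> [S]\<^bsup>2\<^esup>" using e nsets_mono[of "S - R" S 2] by auto
      then have "(SOME x. x \<in> e) \<in> R" unfolding R_def by blast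
      ultimately show False using e by (auto simp: nsets_def)
    qed
  qed auto
qed

context metric_graph
begin

text \<open>The rank of \<open>D\<close> is at least 1, stated without the greatest number in the definition of the rank.\<close>

definition has_pos_rank :: "('a point \<Rightarrow>\<^sub>0 int) \<Rightarrow> bool" where
  "has_pos_rank D \<longleftrightarrow> (\<forall>p\<in>points G. linear_system G (D - Poly_Mapping.single p 1) \<noteq> {})"

lemma has_pos_rankD:
  assumes "has_pos_rank D" "divisor_on G D" "p \<in> points G"
  obtains E where "effective E" "divisor_on G E" "lin_equiv G E D" "1 \<le> Poly_Mapping.lookup E p"
proof -
  obtain E where E: "divisor_on G E" "effective E" "lin_equiv G E (D - Poly_Mapping.single p 1)"
    using assms unfolding has_pos_rank_def linear_system_def by blast
  show thesis
  proof (rule that[of "E + Poly_Mapping.single p 1"])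
    show "lin_equiv G (E + Poly_Mapping.single p 1) D"
      using lin_equiv_add[OF E(3), of "Poly_Mapping.single p 1"] by simp
    show "1 \<le> Poly_Mapping.lookup (E + Poly_Mapping.single p 1) p"
      using E(2) by (simp add: lookup_add effective_def)
  qed (use E assms in \<open>auto intro!: effective_add effective_single divisor_on_add divisor_on_single\<close>)
qed

lemma div_of_le_0_at_max:
  assumes "rational_function G f" "u \<in> verts G"
    and max: "\<And>p. p \<in> points G \<Longrightarrow> f p \<le> f (vertex_point u)"
  shows "adj u v \<Longrightarrow> slope f u v 0 \<le> 0" "div_of G f (vertex_point u) \<le> 0"
proof -
  show *: "slope f u v 0 \<le> 0" if a: "adj u v" for v
  proof (rule rgerm_bound_above)
    show "rgerm (\<lambda>s. f (ep u v s)) 0 (slope f u v 0)"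
      using rational_rgerm[OF assms(1) a] adjD[OF a] by simp
    show "0 < elen u v" using adjD[OF a] by simp
    fix s assume "0 < s" "s < elen u v"
    then show "f (ep u v (0 + s)) \<le> f (ep u v 0) + of_int 0 * s"
      using max[OF ep_in_points[OF a, of s]] by (simp add: ep_start[OF a])
  qed
  show "div_of G f (vertex_point u) \<le> 0"
    unfolding div_of_vertex by (rule sum_nonpos) (use * in auto)
qed

text \<open>If an admissible function is maximal at a vertex \<open>w\<close> without a chip and smaller at the adjacent
  vertex \<open>x\<close>, then there is a chip in the interior of the edge, namely where the function leaves its
  maximum.\<close>

lemma chip_next_to_unoccupied_vertex:
  assumes adm: "admissible D f" and eff: "effective D"
    and a: "adj w x" and max: "\<And>p. p \<in> points G \<Longrightarrow> f p \<le> f (vertex_point w)"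
    and less: "f (vertex_point x) < f (vertex_point w)"
    and w: "Poly_Mapping.lookup D (vertex_point w) = 0"
  shows "\<exists>p\<in>Poly_Mapping.keys D. {y. p y \<noteq> 0} = {w, x}"
proof -
  note rat = admissible_rational[OF adm]
  have nonneg: "0 \<le> Poly_Mapping.lookup D p + div_of G f p" for p
    using adm by (auto simp: admissible_def)
  obtain t where t: "0 \<le> t" "t < elen w x" "slope f w x t < 0"
    "0 < t \<Longrightarrow> slope f x w (elen w x - t) \<le> 0"
  proof (rule leave_max[OF rat a])
    show "f (ep w x t) \<le> f (vertex_point w)" if "0 \<le> t" "t \<le> elen w x" for t
      using that by (intro max ep_in_points a)
  qed (use less in blast)+
  have "t \<noteq> 0"
  proof
    assume t0: "t = 0"
    have "div_of G f (vertex_point w) < 0"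
      unfolding div_of_vertex
    proof -
      have "(\<Sum>v | adj w v. slope f w v 0) < (\<Sum>v | adj w v. 0)"
      proof (rule sum_strict_mono_ex1[OF finite_nbrs])
        show "\<forall>v\<in>{v. adj w v}. slope f w v 0 \<le> 0"
          using div_of_le_0_at_max(1)[OF rat _ max] adjD[OF a] by blast
        show "\<exists>v\<in>{v. adj w v}. slope f w v 0 < 0" using a t(3) t0 by blast
      qed
      then show "(\<Sum>v | adj w v. slope f w v 0) < 0" by simp
    qed
    then show False using nonneg[of "vertex_point w"] w by simp
  qed
  with t have t': "0 < t" by simp
  have "div_of G f (ep w x t) < 0"
    using t(3) t(4)[OF t'] div_of_interior[OF a t' t(2)] by simp
  then have "ep w x t \<in> Poly_Mapping.keys D"
    using nonneg[of "ep w x t"] by (auto simp: in_keys_iff)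
  then show ?thesis using ep_support[OF a t' t(2)] by blast
qed

text \<open>The heart of the lower bound; here the omitted edges are the pairs of vertices that are not
  edges.\<close>

lemma independent_set_of_low_degree:
  assumes card: "3 \<le> card (verts G)" "card ([verts G]\<^bsup>2\<^esup> - edges G) \<le> card (verts G) - 2"
    and D: "divisor_on G D" "has_pos_rank D"
    and deg: "div_degree D < int (card (verts G)) - 2"
  shows "\<exists>S\<subseteq>verts G. edges G \<inter> [S]\<^bsup>2\<^esup> = {} \<and> int (card (verts G)) - div_degree D \<le> int (card S)"
proof -
  define V F d where "V = verts G" and "F = [V]\<^bsup>2\<^esup> - edges G" and "d = card (verts G)"
  have finV: "finite V" and finF: "finite F"
    unfolding F_def V_def using finite_verts by (auto simp: finite_imp_finite_nsets)
  have cardF: "card F \<le> d - 2" and d: "3 \<le> d" "card V = d"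
    using card by (auto simp: V_def F_def d_def)
  have cut_sub: "cut_edges V A - F \<subseteq> edges G" if "A \<subseteq> V" for A
    using that by (auto simp: cut_edges_def F_def)
  \<comment> \<open>There are \<open>a * (d - a) \<ge> d - 1\<close> pairs between \<open>A\<close> and its complement if \<open>a = card A\<close>, and at least
    \<open>2 * (d - 2)\<close> if there are two vertices on both sides; at most \<open>d - 2\<close> of them are not edges.\<close>
  have cut_pos: "1 \<le> card (cut_edges V A - F)" if "A \<subseteq> V" "A \<noteq> {}" "A \<noteq> V" for A
  proof -
    have "1 \<le> card A" "card A < d"
      using that finV psubset_card_mono[of V A] d(2)
      by (auto simp: Suc_le_eq card_gt_0_iff finite_subset)
    define b where "b = d - card A"
    have b: "d = card A + b" "1 \<le> b" using \<open>card A < d\<close> by (auto simp: b_def)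
    have "d - 1 \<le> card A * (d - card A)"
    proof -
      have "0 \<le> (int (card A) - 1) * (int b - 1)" using b \<open>1 \<le> card A\<close> by simp
      then have "int (card A + b) \<le> int (card A * b + 1)" by (simp add: algebra_simps)
      then have "card A + b \<le> card A * b + 1" by (simp only: of_nat_le_iff)
      then show ?thesis using b by simp
    qed
    then show ?thesis
      using card_cut_edges_minus[OF finV that(1) finF] cardF d by simp
  qed
  have cut_big: "d - 2 \<le> card (cut_edges V A - F)" if "A \<subseteq> V" "2 \<le> card A" "card A \<le> d - 2" for A
  proof -
    define b where "b = d - card A"
    have b: "d = card A + b" "2 \<le> b" using that d by (auto simp: b_def)
    have "0 \<le> (int (card A) - 2) * (int b - 2)" using b that by simp
    then have "int (2 * (card A + b)) \<le> int (card A * b + 4)" by (simp add: algebra_simps)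
    then have "2 * (card A + b) \<le> card A * b + 4" by (simp only: of_nat_le_iff)
    then have "2 * (d - 2) \<le> card A * (d - card A)" using b by simp
    then show ?thesis
      using card_cut_edges_minus[OF finV that(1) finF] cardF d by simp
  qed
  have "F \<subseteq> [V]\<^bsup>2\<^esup>" "card F < card V" using cardF d by (auto simp: F_def)
  then obtain v0 where v0: "v0 \<in> V" "card {e \<in> F. v0 \<in> e} \<le> 1"
    using ex_vertex_in_few_edges[OF finV, of F] by blast
  have cut_v0: "d - 2 \<le> card (cut_edges V {v0} - F)"
  proof -
    have "cut_edges V {v0} - F = cut_edges V {v0} - {e \<in> F. v0 \<in> e}"
      by (auto simp: cut_edges_def)
    moreover have "card {v0} * (card V - card {v0}) - card {e \<in> F. v0 \<in> e}
      \<le> card (cut_edges V {v0} - {e \<in> F. v0 \<in> e})"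
      using v0 finV finF by (intro card_cut_edges_minus) auto
    ultimately show ?thesis using v0 d by simp
  qed
  have conn: "(v0, u) \<in> {(u, v). adj u v}\<^sup>*" if "u \<in> verts G" for u
  proof (rule ccontr)
    assume neg: "(v0, u) \<notin> {(u, v). adj u v}\<^sup>*"
    define A where "A = {u \<in> V. (v0, u) \<in> {(u, v). adj u v}\<^sup>*}"
    have "A \<subseteq> V" "A \<noteq> {}" "A \<noteq> V" using neg v0 that by (auto simp: A_def V_def)
    from cut_pos[OF this] have "cut_edges V A - F \<noteq> {}" by (metis card.empty not_one_le_zero)
    then obtain x y where xy: "x \<in> A" "y \<in> V - A" "{x, y} \<in> cut_edges V A - F"
      by (auto simp: cut_edges_def)
    then have "adj x y" using cut_sub[OF \<open>A \<subseteq> V\<close>] by blast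
    with xy show False by (auto simp: A_def intro: rtrancl_into_rtrancl)
  qed
  obtain D0 where D0: "effective D0" "divisor_on G D0" "lin_equiv G D0 D"
    using has_pos_rankD[OF D(2,1) vertex_in_points] v0 unfolding V_def by blast
  obtain g0 where g0: "admissible D0 g0"
    "\<And>g p. admissible (plus_div D0 g0) g \<Longrightarrow> p \<in> points G \<Longrightarrow> g p \<le> g (vertex_point v0)"
    using reduced_divisor_exists[OF D0(1,2) _ conn] v0 unfolding V_def by blast
  define D1 where "D1 = plus_div D0 g0"
  have rat0: "rational_function G g0" using g0(1) by (rule admissible_rational)
  have eff: "effective D1" unfolding D1_def by (rule admissible_effective[OF g0(1)])
  have equiv: "lin_equiv G D1 D"
    unfolding D1_def by (rule lin_equiv_trans[OF lin_equiv_plus_div[OF rat0] D0(3)])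
  have deg1: "div_degree D1 = div_degree D" by (rule lin_equiv_degree[OF equiv])
  \<comment> \<open>A level set that contains \<open>v0\<close> but not \<open>x\<close> is the complement of \<open>x\<close>, all other cuts being larger than
    the degree.\<close>
  have no_cut: "A = V - {x}"
    if g: "admissible D1 g" and A: "A = {u \<in> V. c < g (vertex_point u)}"
      and c: "\<And>u. u \<in> verts G \<Longrightarrow> g (vertex_point u) \<noteq> c"
      and x: "x \<in> V" "g (vertex_point x) < c" and "v0 \<in> A" for g A c x
  proof (rule ccontr)
    assume neg: "\<not> ?thesis"
    have "A \<subseteq> V" using A by blast
    have "cut_edges V A - F
      \<subseteq> {{u, v} | u v. adj u v \<and> g (vertex_point u) < c \<and> c < g (vertex_point v)}"
    proof
      fix e assume e: "e \<in> cut_edges V A - F"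
      then obtain u v where uv: "u \<in> A" "v \<in> V - A" "e = {v, u}"
        by (auto simp: cut_edges_def insert_commute)
      with e cut_sub[OF \<open>A \<subseteq> V\<close>] have "adj v u" by blast
      moreover have "c < g (vertex_point u)" "g (vertex_point v) < c"
        using uv A c[of v] by (auto simp: V_def less_le)
      ultimately show "e \<in> {{u, v} | u v. adj u v \<and> g (vertex_point u) < c \<and> c < g (vertex_point v)}"
        using uv(3) by blast
    qed
    then have "card (cut_edges V A - F)
      \<le> card {{u, v} | u v. adj u v \<and> g (vertex_point u) < c \<and> c < g (vertex_point v)}"
      by (rule card_mono[rotated]) (rule finite_subset[OF _ finite_edges], auto)
    also have "int \<dots> \<le> div_degree D1" by (rule card_cut_le_degree[OF g eff c])
    finally have less: "int (card (cut_edges V A - F)) < int d - 2"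
      using deg deg1 by (simp add: d_def)
    have "A \<subseteq> V - {x}" using A x by auto
    with neg have "A \<subset> V - {x}" by blast
    then have "card A < card (V - {x})" using finV by (intro psubset_card_mono) auto
    then have "card A \<le> d - 2" using x(1) finV d by simp
    moreover have "card A \<noteq> 0"
      using \<open>v0 \<in> A\<close> finite_subset[OF \<open>A \<subseteq> V\<close> finV] by auto
    moreover have "card A \<noteq> 1"
    proof
      assume "card A = 1"
      with \<open>v0 \<in> A\<close> have "A = {v0}" by (auto simp: card_1_singleton_iff)
      with cut_v0 less d show False by simp
    qed
    ultimately have "d - 2 \<le> card (cut_edges V A - F)"
      by (intro cut_big \<open>A \<subseteq> V\<close>) auto
    with less d show False by simp
  qed
  define S where "S = {x \<in> V. Poly_Mapping.lookup D1 (vertex_point x) = 0}"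
  have chip: "\<exists>p\<in>Poly_Mapping.keys D1. {y. p y \<noteq> 0} = {w, x}"
    if x: "x \<in> S" and w: "w \<in> S" and a: "adj w x" for w x
  proof -
    have xV: "x \<in> verts G" and wV: "w \<in> verts G" "w \<noteq> x" using adjD[OF a] by auto
    obtain E where E: "effective E" "lin_equiv G E D" "1 \<le> Poly_Mapping.lookup E (vertex_point x)"
      using has_pos_rankD[OF D(2,1) vertex_in_points[OF xV]] by blast
    from lin_equiv_trans[OF E(2) lin_equiv_sym[OF equiv]] obtain f
      where f: "rational_function G f" "Poly_Mapping.lookup (E - D1) = div_of G f"
      unfolding lin_equiv_def by blast
    have fE: "Poly_Mapping.lookup D1 p + div_of G f p = Poly_Mapping.lookup E p" for p
      using fun_cong[OF f(2), of p] by (simp add: lookup_minus)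
    have adm_f: "admissible D1 f" using f(1) E(1) by (simp add: admissible_def fE effective_def)
    define m where "m = f (vertex_point x)"
    define g where "g = (\<lambda>p. max (f p) m)"
    have adm: "admissible D1 g" unfolding g_def by (rule admissible_max_const[OF adm_f eff])
    have top: "g p \<le> g (vertex_point v0)" if "p \<in> points G" for p
      using g0(2)[OF adm[unfolded D1_def] that] .
    define M where "M = g (vertex_point v0)"
    have gx: "g (vertex_point x) = m" by (simp add: g_def m_def)
    \<comment> \<open>If not, \<open>f\<close> is maximal at \<open>x\<close> and cannot bring a chip there. This includes the case \<open>x = v0\<close>.\<close>
    have "m < M"
    proof (rule ccontr)
      assume "\<not> m < M"
      then have "f p \<le> f (vertex_point x)" if "p \<in> points G" for p
        using top[OF that] by (simp add: M_def g_def m_def)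
      then have "div_of G f (vertex_point x) \<le> 0" by (rule div_of_le_0_at_max(2)[OF f(1) xV])
      then show False using fE[of "vertex_point x"] E(3) x by (simp add: S_def)
    qed
    \<comment> \<open>Otherwise a level \<open>c\<close> between the two values, different from the values at all vertices, has both
      \<open>v\<close> and \<open>x\<close> below it.\<close>
    have gM: "g (vertex_point v) = M" if v: "v \<in> V" "v \<noteq> x" for v
    proof (rule ccontr)
      assume "g (vertex_point v) \<noteq> M"
      then have "g (vertex_point v) < M"
        using top[OF vertex_in_points[of v]] v by (auto simp: M_def V_def less_le)
      then have "infinite {g (vertex_point v)<..<M}" by (rule infinite_Ioo)
      then have "{g (vertex_point v)<..<M} - (\<lambda>u. g (vertex_point u)) ` verts G \<noteq> {}"
        using finite_verts by (metis finite.emptyI finite_imageI finite_Diff2)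
      then obtain c where "c \<in> {g (vertex_point v)<..<M} - (\<lambda>u. g (vertex_point u)) ` verts G"
        by blast
      then have c: "g (vertex_point v) < c" "c < M"
        "\<And>u. u \<in> verts G \<Longrightarrow> g (vertex_point u) \<noteq> c" by auto
      define A where "A = {u \<in> V. c < g (vertex_point u)}"
      have "v0 \<in> A" using v0 c by (simp add: A_def M_def)
      moreover have "g (vertex_point x) < c" using c(1) unfolding gx by (simp add: g_def)
      moreover have "x \<in> V" using xV by (simp add: V_def)
      ultimately have "A = V - {x}" using no_cut[OF adm A_def c(3)] by blast
      moreover have "v \<notin> A" "x \<notin> A" using c \<open>g (vertex_point x) < c\<close> by (auto simp: A_def)
      ultimately show False using v \<open>v0 \<in> A\<close> \<open>x \<in> V\<close> by blast
    qed
    show ?thesis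
    proof (rule chip_next_to_unoccupied_vertex[OF adm eff a])
      show "g p \<le> g (vertex_point w)" if "p \<in> points G" for p
        using top[OF that] gM[of w] wV by (simp add: M_def V_def)
      show "g (vertex_point x) < g (vertex_point w)"
        using gM[of w] wV \<open>m < M\<close> gx by (simp add: V_def)
      show "Poly_Mapping.lookup D1 (vertex_point w) = 0" using w by (simp add: S_def)
    qed
  qed
  define X where "X = (edges G \<inter> [S]\<^bsup>2\<^esup>) \<union> (\<lambda>v. {v}) ` (V - S)"
  have "X \<subseteq> (\<lambda>p. {y. p y \<noteq> 0}) ` Poly_Mapping.keys D1"
  proof
    fix e assume "e \<in> X"
    then consider "e \<in> edges G" "e \<in> [S]\<^bsup>2\<^esup>" | v where "v \<in> V" "v \<notin> S" "e = {v}"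
      by (auto simp: X_def)
    then show "e \<in> (\<lambda>p. {y. p y \<noteq> 0}) ` Poly_Mapping.keys D1"
    proof cases
      case 1
      then obtain w x where e: "e = {w, x}" "w \<in> S" "x \<in> S" by (auto elim: nsets2_E)
      with 1 have "adj w x" by simp
      from chip[OF e(3,2) this] obtain p where "p \<in> Poly_Mapping.keys D1" "e = {y. p y \<noteq> 0}"
        unfolding e(1) by auto
      then show ?thesis by (intro rev_image_eqI[where f = "\<lambda>p. {y. p y \<noteq> 0}"])
    next
      case 2
      then have "vertex_point v \<in> Poly_Mapping.keys D1" by (auto simp: S_def in_keys_iff)
      moreover have "e = {y. vertex_point v y \<noteq> 0}" unfolding 2 vertex_point_support ..
      ultimately show ?thesis by (intro rev_image_eqI[where f = "\<lambda>p. {y. p y \<noteq> 0}"])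
    qed
  qed
  from card_supports_le_degree[OF eff this] have "int (card X) \<le> div_degree D" by (simp add: deg1)
  moreover have "card X = card (edges G \<inter> [S]\<^bsup>2\<^esup>) + card (V - S)"
  proof -
    have "card X = card (edges G \<inter> [S]\<^bsup>2\<^esup>) + card ((\<lambda>v. {v}) ` (V - S))"
      unfolding X_def using finite_edges finV by (intro card_Un_disjoint) (auto simp: nsets_def)
    then show ?thesis by (simp add: card_image)
  qed
  moreover have "card (V - S) = d - card S" "card S \<le> d"
    using finV d by (auto simp: S_def card_Diff_subset intro: card_mono)
  ultimately have le: "int d - div_degree D \<le> int (card S) - int (card (edges G \<inter> [S]\<^bsup>2\<^esup>))"
    by simp
  obtain T where T: "T \<subseteq> S" "card S - card (edges G \<inter> [S]\<^bsup>2\<^esup>) \<le> card T" "edges G \<inter> [T]\<^bsup>2\<^esup> = {}"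
    using ex_independent_subset[OF finite_edges] by blast
  with le have "int d - div_degree D \<le> int (card T)" by linarith
  moreover have "T \<subseteq> verts G" using T(1) by (auto simp: S_def V_def)
  ultimately show ?thesis using T(3) unfolding d_def by blast
qed

end

section \<open>The upper bound\<close>

lemma rgerm_tent:
  assumes "0 < s" "2 * s \<le> b - a"
  shows "rgerm (\<lambda>t. - max 0 (min s (min (t - a) (b - t)))) t
    ((if b - s \<le> t \<and> t < b then 1 else 0) - (if a \<le> t \<and> t < a + s then 1 else 0))"
    (is "rgerm ?\<phi> t _")
proof -
  consider "t < a" | "a \<le> t" "t < a + s" | "a + s \<le> t" "t < b - s" | "b - s \<le> t" "t < b" | "b \<le> t"
    by linarith
  then show ?thesis
  proof cases
    case 1
    have "rgerm ?\<phi> t 0" by (rule rgerm_linear[of t t a]) (use 1 assms in auto)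
    with 1 assms show ?thesis by auto
  next
    case 2
    have "rgerm ?\<phi> t (- 1)" by (rule rgerm_linear[of a t "a + s"]) (use 2 assms in auto)
    with 2 assms show ?thesis by auto
  next
    case 3
    have "rgerm ?\<phi> t 0" by (rule rgerm_linear[of "a + s" t "b - s"]) (use 3 assms in auto)
    with 3 assms show ?thesis by auto
  next
    case 4
    have "rgerm ?\<phi> t 1" by (rule rgerm_linear[of "b - s" t b]) (use 4 assms in auto)
    with 4 assms show ?thesis by auto
  next
    case 5
    have "rgerm ?\<phi> t 0" by (rule rgerm_linear[of t t "t + 1"]) (use 5 assms in auto)
    with 5 assms show ?thesis by auto
  qed
qed

lemma rgerm_ramp: "rgerm (\<lambda>t. - min m t) t (if t < m then - 1 else 0)"
proof (cases "t < m")
  case True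
  have "rgerm (\<lambda>t. - min m t) t (- 1)" by (rule rgerm_linear[of t t m]) (use True in auto)
  with True show ?thesis by simp
next
  case False
  have "rgerm (\<lambda>t. - min m t) t 0" by (rule rgerm_linear[of t t "t + 1"]) (use False in auto)
  with False show ?thesis by simp
qed

lemma rgerm_ramp_rev: "rgerm (\<lambda>t. - min m (L - t)) t (if t < L - m then 0 else 1)"
proof (cases "t < L - m")
  case True
  have "rgerm (\<lambda>t. - min m (L - t)) t 0" by (rule rgerm_linear[of t t "L - m"]) (use True in auto)
  with True show ?thesis by simp
next
  case False
  have "rgerm (\<lambda>t. - min m (L - t)) t 1" by (rule rgerm_linear[of t t "t + 1"]) (use False in auto)
  with False show ?thesis by simp
qed

context metric_graph
begin

text \<open>The function that moves one chip from each of the points at distance \<open>a\<close> and \<open>b\<close> from \<open>u\<close> by the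
  distance \<open>s\<close> towards the other. The formula in barycentric coordinates is valid on the whole graph,
  because one of \<open>p u\<close> and \<open>p v\<close> vanishes off the edge \<open>{u, v}\<close>.\<close>

lemma div_of_tent:
  assumes a: "adj u v" and s: "0 \<le> a" "b \<le> elen u v" "0 < s" "2 * s \<le> b - a"
  defines "f \<equiv> \<lambda>p. - max 0 (min s (min (elen u v * p v - a) (elen u v * p u - (elen u v - b))))"
  shows "rational_function G f"
    and "div_of G f p = (if p = ep u v (a + s) then 1 else 0) + (if p = ep u v (b - s) then 1 else 0)
      - (if p = ep u v a then 1 else 0) - (if p = ep u v b then 1 else 0)"
proof -
  let ?L = "elen u v"
  have uv: "u \<noteq> v" "0 < ?L" "adj v u" "elen v u = ?L" using adjD[OF a] by auto
  have ab: "a < b" "0 < a + s" "a + s < ?L" "0 < b - s" "b - s < ?L" using s by auto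
  \<comment> \<open>The slope towards \<open>v\<close> at distance \<open>t\<close> from \<open>u\<close>. Seen from \<open>v\<close>, the function has the same shape with
    \<open>a\<close> and \<open>b\<close> replaced by \<open>elen u v - b\<close> and \<open>elen u v - a\<close>.\<close>
  define \<sigma> where "\<sigma> a b t = (if b - s \<le> t \<and> t < b then 1 else 0 :: int)
      - (if a \<le> t \<and> t < a + s then 1 else 0)" for a b t
  have g1: "rgerm (\<lambda>t. f (ep u v t)) t (\<sigma> a b t)" for t
  proof -
    have "f (ep u v t) = - max 0 (min s (min (t - a) (b - t)))" for t
      using uv by (simp add: f_def edge_point_def right_diff_distrib)
    then show ?thesis using rgerm_tent[OF s(3,4)] by (simp add: \<sigma>_def)
  qed
  have g2: "rgerm (\<lambda>t. f (ep v u t)) t (\<sigma> (?L - b) (?L - a) t)" for t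
  proof -
    have "f (ep v u t) = - max 0 (min s (min (t - (?L - b)) ((?L - a) - t)))" for t
      using uv by (simp add: f_def edge_point_def right_diff_distrib min.commute algebra_simps)
    then show ?thesis using rgerm_tent[OF s(3), of "?L - a" "?L - b"] s(4) by (simp add: \<sigma>_def)
  qed
  have g3: "rgerm (\<lambda>t. f (ep x y t)) t 0"
    if xy: "adj x y" "{x, y} \<noteq> {u, v}" and t: "0 \<le> t" "t < elen x y" for x y t
  proof (rule rgerm_cong[OF rgerm_const[of 0], of "elen x y - t"])
    fix r assume "0 \<le> r" "r < elen x y - t"
    have "u \<notin> {x, y} \<or> v \<notin> {x, y}" using xy adjD[OF xy(1)] uv by auto
    then have "ep x y (t + r) u = 0 \<or> ep x y (t + r) v = 0" by (auto simp: edge_point_def)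
    then show "f (ep x y (t + r)) = 0" using s(1,2) by (auto simp: f_def)
  qed (use t in auto)
  show rat: "rational_function G f"
  proof (rule rational_functionI)
    fix x y t assume xyt: "adj x y" "0 \<le> t" "t < elen x y"
    consider "x = u" "y = v" | "x = v" "y = u" | "{x, y} \<noteq> {u, v}"
      by (auto simp: doubleton_eq_iff)
    then show "\<exists>m. rgerm (\<lambda>s. f (ep x y s)) t m"
    proof cases
      case 1
      then show ?thesis using g1[of t] by auto
    next
      case 2
      then show ?thesis using g2[of t] by auto
    next
      case 3
      then show ?thesis using g3[OF xyt(1) _ xyt(2,3)] by blast
    qed
  qed
  have s1: "slope f u v t = \<sigma> a b t" for t by (rule slope_eqI[OF g1])
  have s2: "slope f v u t = \<sigma> (?L - b) (?L - a) t" for t by (rule slope_eqI[OF g2])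
  have s3: "slope f x y t = 0"
    if "adj x y" "{x, y} \<noteq> {u, v}" "0 \<le> t" "t < elen x y" for x y t
    by (rule slope_eqI[OF g3[OF that]])
  have inner: "div_of G f (ep u v t) = (if t = a + s then 1 else 0) + (if t = b - s then 1 else 0)
      - (if t = a then 1 else 0) - (if t = b then 1 else 0)" if "0 < t" "t < ?L" for t
    using s div_of_interior[OF a that, of f] by (simp add: s1 s2 \<sigma>_def)
  have inj: "ep u v t = ep u v c \<longleftrightarrow> t = c" for t c using ep_inj[OF a] by auto
  show "div_of G f p = (if p = ep u v (a + s) then 1 else 0) + (if p = ep u v (b - s) then 1 else 0)
      - (if p = ep u v a then 1 else 0) - (if p = ep u v b then 1 else 0)"
  proof (cases "p \<in> points G")
    case False
    then have "p \<noteq> ep u v c" if "0 \<le> c" "c \<le> ?L" for c using ep_in_points[OF a that] by auto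
    then show ?thesis using False s ab by (simp add: div_of_outside)
  next
    case True
    then show ?thesis
    proof (cases rule: point_cases)
      case (vertex w)
      have nv: "vertex_point w \<noteq> ep u v (a + s)" "vertex_point w \<noteq> ep u v (b - s)"
        using ep_eq_vertex[OF a, of "a + s" w] ep_eq_vertex[OF a, of "b - s" w] ab by auto
      have va: "vertex_point w = ep u v a \<longleftrightarrow> a = 0 \<and> w = u"
        using ep_eq_vertex[OF a, of a w] ep_start[OF a] s ab by force
      have vb: "vertex_point w = ep u v b \<longleftrightarrow> b = ?L \<and> w = v"
        using ep_eq_vertex[OF a, of b w] ep_end[OF a] s ab by force
      have "div_of G f p = (\<Sum>y | adj w y. (if w = u \<and> y = v then slope f u v 0 else 0)
          + (if w = v \<and> y = u then slope f v u 0 else 0))"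
        unfolding vertex(2) div_of_vertex
        by (rule sum.cong) (use s3[of w _ 0] adjD(4) uv(1) in \<open>auto simp: doubleton_eq_iff\<close>)
      also have "\<dots> = (if w = u then slope f u v 0 else 0) + (if w = v then slope f v u 0 else 0)"
        using finite_nbrs[of w] a uv(1,3) by (auto simp: sum.distrib)
      also have "\<dots> = - (if a = 0 \<and> w = u then 1 else 0) - (if b = ?L \<and> w = v then 1 else 0)"
        using s ab uv(1) by (auto simp: s1 s2 \<sigma>_def)
      finally show ?thesis using nv va vb by (simp add: vertex(2))
    next
      case (interior x y t)
      consider "x = u" "y = v" | "x = v" "y = u" | "{x, y} \<noteq> {u, v}" by (auto simp: doubleton_eq_iff)
      then show ?thesis
      proof cases
        case 1
        then show ?thesis using inner[of t] interior
          by (simp add: inj)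
      next
        case 2
        then have "p = ep u v (?L - t)" using interior ep_reverse[OF a] by simp
        then show ?thesis
          using inner[of "?L - t"] interior 2 uv
          by (simp add: inj algebra_simps)
      next
        case 3
        have "p \<noteq> ep u v c" if c: "0 \<le> c" "c \<le> ?L" for c
        proof
          assume "p = ep u v c"
          with interior(4) have "ep u v c = ep x y t" by simp
          from ep_eq_interior[OF interior(1-3) a c this] 3 show False by blast
        qed
        moreover have "div_of G f p = 0"
        proof -
          have "slope f x y t = 0" using interior 3 by (intro s3) auto
          moreover have "{y, x} \<noteq> {u, v}" using 3 by (simp add: insert_commute)
          then have "slope f y x (elen x y - t) = 0"
            using interior adjD(5,6)[OF interior(1)] by (intro s3) auto
          ultimately show ?thesis
            unfolding interior(4) div_of_interior[OF interior(1-3)] by simp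
        qed
        ultimately show ?thesis using s ab by simp
      qed
    qed
  qed
qed

text \<open>Some effective divisor linearly equivalent to \<open>D\<close> has a chip at \<open>p\<close>.\<close>

definition reaches :: "('a point \<Rightarrow>\<^sub>0 int) \<Rightarrow> 'a point \<Rightarrow> bool" where
  "reaches D p \<longleftrightarrow> (\<exists>f. admissible D f \<and> 1 \<le> Poly_Mapping.lookup D p + div_of G f p)"

lemma reaches_chip:
  assumes "effective D" "1 \<le> Poly_Mapping.lookup D p"
  shows "reaches D p"
  unfolding reaches_def using assms
  by (intro exI[of _ "\<lambda>p. 0"]) (auto simp: admissible_def rational_const div_of_const effective_def)

lemma reaches_plus_div:
  assumes "admissible D f" "reaches (plus_div D f) p"
  shows "reaches D p"
proof -
  note rat = admissible_rational[OF assms(1)]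
  obtain g where g: "admissible (plus_div D f) g"
    "1 \<le> Poly_Mapping.lookup (plus_div D f) p + div_of G g p"
    using assms(2) unfolding reaches_def by blast
  note ratg = admissible_rational[OF g(1)]
  show ?thesis
    unfolding reaches_def admissible_def
  proof (intro exI[of _ "\<lambda>p. f p + g p"] conjI allI)
    show "rational_function G (\<lambda>p. f p + g p)" by (rule rational_add[OF rat ratg])
    show "0 \<le> Poly_Mapping.lookup D p + div_of G (\<lambda>p. f p + g p) p" for p
      using g(1) by (simp add: admissible_def div_of_add[OF rat ratg] lookup_plus_div[OF rat] add.assoc)
    show "1 \<le> Poly_Mapping.lookup D p + div_of G (\<lambda>p. f p + g p) p"
      using g(2) by (simp add: div_of_add[OF rat ratg] lookup_plus_div[OF rat])
  qed
qed

lemma has_pos_rankI: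
  assumes "divisor_on G D" "\<And>p. p \<in> points G \<Longrightarrow> reaches D p"
  shows "has_pos_rank D"
  unfolding has_pos_rank_def
proof
  fix p assume p: "p \<in> points G"
  then obtain f where "admissible D f" "1 \<le> Poly_Mapping.lookup D p + div_of G f p"
    using assms(2) unfolding reaches_def by blast
  then have "admissible (D - Poly_Mapping.single p 1) f"
    by (auto simp: admissible_def lookup_minus lookup_single when_def)
  then show "linear_system G (D - Poly_Mapping.single p 1) \<noteq> {}"
    using linear_system_iff[OF divisor_on_diff[OF assms(1) divisor_on_single[OF p]]] by blast
qed

lemma reaches_between:
  assumes "effective D" and a: "adj u v" and ab: "0 \<le> a" "a \<le> t" "t \<le> b" "b \<le> elen u v"
    and chips: "1 \<le> Poly_Mapping.lookup D (ep u v a)" "1 \<le> Poly_Mapping.lookup D (ep u v b)"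
  shows "reaches D (ep u v t)"
proof (cases "t = a \<or> t = b")
  case True
  then show ?thesis using reaches_chip assms by auto
next
  case False
  define s where "s = min (t - a) (b - t)"
  have s: "0 < s" "2 * s \<le> b - a" using False ab by (auto simp: s_def min_def)
  obtain f where rat: "rational_function G f" and f:
    "\<And>p. div_of G f p = (if p = ep u v (a + s) then 1 else 0) + (if p = ep u v (b - s) then 1 else 0)
      - (if p = ep u v a then 1 else 0) - (if p = ep u v b then 1 else 0)"
    using div_of_tent[OF a ab(1,4) s] by blast
  have inj: "ep u v t = ep u v c \<longleftrightarrow> t = c" for t c using ep_inj[OF a] by auto
  have D: "0 \<le> Poly_Mapping.lookup D p" for p using assms(1) by (simp add: effective_def)
  have "0 \<le> Poly_Mapping.lookup D p + div_of G f p" for p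
    unfolding f using chips D[of p] s(1,2) by (auto simp: inj)
  moreover have "t = a + s \<or> t = b - s" by (auto simp: s_def)
  then have "1 \<le> div_of G f (ep u v t)"
    unfolding f using False by (auto simp: inj)
  then have "1 \<le> Poly_Mapping.lookup D (ep u v t) + div_of G f (ep u v t)"
    using D[of "ep u v t"] by linarith
  ultimately show ?thesis unfolding reaches_def admissible_def using rat by blast
qed

text \<open>One chip on every neighbour of \<open>x\<close> moves the distance \<open>m\<close> towards \<open>x\<close>.\<close>

lemma move_chips_towards:
  assumes eff: "effective D" and chips: "\<And>w. adj w x \<Longrightarrow> 1 \<le> Poly_Mapping.lookup D (vertex_point w)"
    and m: "0 < m" "\<And>w. adj w x \<Longrightarrow> m \<le> elen w x"
  shows "\<exists>f. admissible D f \<and>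
    (\<forall>w. adj w x \<longrightarrow> 1 \<le> Poly_Mapping.lookup D (ep w x m) + div_of G f (ep w x m))"
proof -
  \<comment> \<open>On the edge from \<open>w\<close> to \<open>x\<close> this is \<open>- min m t\<close> at distance \<open>t\<close> from \<open>w\<close>, since there the sum has the
    only term \<open>elen w x\<close>. At \<open>x\<close> itself the sum is empty, so the value is prescribed.\<close>
  define f where "f = (\<lambda>p :: 'a point. if p x = 1 then - m
    else - min m (p x * (\<Sum>w | adj w x \<and> p w \<noteq> 0. elen w x)))"
  have f_edge: "f (ep w x t) = - min m t" if a: "adj w x" and t: "0 \<le> t" "t \<le> elen w x" for w t
  proof -
    have wx: "w \<noteq> x" "0 < elen w x" using adjD[OF a] by auto
    have px: "ep w x t x = t / elen w x" using wx by (simp add: edge_point_def)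
    consider "t = elen w x" | "t = 0" | "0 < t" "t < elen w x" using t by linarith
    then show ?thesis
    proof cases
      case 1
      then show ?thesis using px wx m(2)[OF a] by (simp add: f_def)
    next
      case 2
      then show ?thesis using px m(1) by (simp add: f_def)
    next
      case 3
      have "{w'. adj w' x \<and> ep w x t w' \<noteq> 0} = {w}"
        using ep_support[OF a 3] a adjD(1)[of x x] by auto
      then show ?thesis using px wx 3 by (simp add: f_def)
    qed
  qed
  have g1: "rgerm (\<lambda>t. f (ep w x t)) t (if t < m then - 1 else 0)"
    if a: "adj w x" and t: "0 \<le> t" "t < elen w x" for w t
    by (rule rgerm_cong[OF rgerm_ramp, of "elen w x - t"]) (use t f_edge[OF a] in auto)
  have g2: "rgerm (\<lambda>t. f (ep x w t)) t (if t < elen w x - m then 0 else 1)"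
    if a: "adj w x" and t: "0 \<le> t" "t < elen w x" for w t
  proof (rule rgerm_cong[OF rgerm_ramp_rev, of "elen w x - t"])
    fix s assume "0 \<le> s" "s < elen w x - t"
    then show "f (ep x w (t + s)) = - min m (elen w x - (t + s))"
      using f_edge[OF a, of "elen w x - (t + s)"] t ep_reverse[OF a] by simp
  qed (use t in auto)
  have g3: "rgerm (\<lambda>t. f (ep u v t)) t 0" if "x \<noteq> u" "x \<noteq> v" for u v t
    by (rule rgerm_cong[OF rgerm_const[of 0], of 1]) (use that m(1) in \<open>auto simp: f_def edge_point_def\<close>)
  have rat: "rational_function G f"
  proof (rule rational_functionI)
    fix u v t assume "adj u v" "0 \<le> t" "t < elen u v"
    then show "\<exists>m. rgerm (\<lambda>s. f (ep u v s)) t m"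
      using g1[of u t] g2[of v t] g3[of u v t] adjD[of u v] by (cases "x = u"; cases "x = v") auto
  qed
  have div_x: "div_of G f (vertex_point x) = int (card {w. adj w x \<and> elen w x = m})"
  proof -
    have "div_of G f (vertex_point x) = (\<Sum>w | adj x w. if elen w x = m then 1 else 0)"
      unfolding div_of_vertex
    proof (rule sum.cong[OF refl])
      fix w assume "w \<in> {w. adj x w}"
      then have a: "adj w x" "0 < elen w x" using adjD[of x w] by auto
      then show "slope f x w 0 = (if elen w x = m then 1 else 0)"
        using slope_eqI[OF g2[of w 0]] m(2)[of w] by auto
    qed
    also have "\<dots> = int (card {w. adj w x \<and> elen w x = m})"
      using finite_nbrs[of x] by (simp add: sum.If_cases Int_def insert_commute)
    finally show ?thesis .
  qed
  have div_w: "div_of G f (vertex_point w) = (if adj w x then - 1 else 0)" if "w \<noteq> x" for w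
  proof -
    have "div_of G f (vertex_point w) = (\<Sum>y | adj w y. if y = x then - 1 else 0)"
      unfolding div_of_vertex
    proof (rule sum.cong[OF refl])
      fix y assume "y \<in> {y. adj w y}"
      then have a: "adj w y" "0 < elen w y" using adjD[of w y] by auto
      then show "slope f w y 0 = (if y = x then - 1 else 0)"
        using slope_eqI[OF g1[of w 0]] slope_eqI[OF g3[of w y 0]] m(1) that by auto
    qed
    then show ?thesis using finite_nbrs[of w] by simp
  qed
  have div_i: "div_of G f (ep w x t) = (if t = m then 1 else 0)"
    if a: "adj w x" and t: "0 < t" "t < elen w x" for w t
    using div_of_interior[OF a t, of f] slope_eqI[OF g1[OF a, of t]]
      slope_eqI[OF g2[OF a, of "elen w x - t"]] t by auto
  have div_o: "div_of G f (ep u v t) = 0"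
    if a: "adj u v" and t: "0 < t" "t < elen u v" and "x \<noteq> u" "x \<noteq> v" for u v t
    using div_of_interior[OF a t, of f] slope_eqI[OF g3] that by auto
  have D: "0 \<le> Poly_Mapping.lookup D p" for p using eff by (simp add: effective_def)
  show ?thesis
  proof (intro exI[of _ f] conjI allI impI)
    have "0 \<le> Poly_Mapping.lookup D p + div_of G f p" for p
    proof (cases "p \<in> points G")
      case True
      then show ?thesis
      proof (cases rule: point_cases)
        case (vertex w)
        then show ?thesis using D[of p] div_x div_w[of w] chips[of w] by (cases "w = x") auto
      next
        case (interior u v t)
        consider "x = v" | "x = u" | "x \<noteq> u" "x \<noteq> v" by blast
        then have "0 \<le> div_of G f p"
        proof cases
          case 1
          then show ?thesis using interior div_i[of u t] by simp
        next
          case 2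
          then have "adj v x" "p = ep v x (elen v x - t)" "elen v x = elen u v"
            using interior adjD[OF interior(1)] ep_reverse[of v u t] by auto
          then show ?thesis using div_i[of v "elen v x - t"] interior by simp
        next
          case 3
          then show ?thesis using interior div_o[of u v t] by simp
        qed
        with D[of p] show ?thesis by simp
      qed
    qed (simp add: D div_of_outside)
    then show "admissible D f" unfolding admissible_def using rat by blast
    fix w assume a: "adj w x"
    have "1 \<le> div_of G f (ep w x m)"
    proof (cases "m = elen w x")
      case True
      have "finite {w. adj w x \<and> elen w x = m}"
        by (rule finite_subset[of _ "verts G"]) (use adjD finite_verts in auto)
      then have "1 \<le> card {w. adj w x \<and> elen w x = m}"
        using a True by (auto simp: Suc_le_eq card_gt_0_iff)
      with div_x show ?thesis by (simp add: True ep_end[OF a])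
    next
      case False
      then show ?thesis using div_i[OF a m(1)] m(2)[OF a] by simp
    qed
    with D[of "ep w x m"] show "1 \<le> Poly_Mapping.lookup D (ep w x m) + div_of G f (ep w x m)"
      by linarith
  qed
qed

text \<open>Points on the edge near \<open>w\<close> are reached directly. Otherwise move the chips until the first one arrives
  at \<open>x\<close>; the remaining part of the edge then has chips at both ends.\<close>

lemma reaches_into_vertex:
  assumes eff: "effective D" and chips: "\<And>w. adj w x \<Longrightarrow> 1 \<le> Poly_Mapping.lookup D (vertex_point w)"
    and a: "adj w x" and t: "0 < t" "t \<le> elen w x"
  shows "reaches D (ep w x t)"
proof -
  define A where "A = (\<lambda>w. elen w x) ` {w. adj w x}"
  have fin: "finite A"
    unfolding A_def by (intro finite_imageI finite_subset[OF _ finite_verts]) (use adjD in auto)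
  have "A \<noteq> {}" using a by (auto simp: A_def)
  define m where "m = Min A"
  have le_m: "m \<le> elen w x" if "adj w x" for w
    using fin that by (auto simp: m_def A_def)
  from Min_in[OF fin \<open>A \<noteq> {}\<close>] obtain w0 where w0: "adj w0 x" "elen w0 x = m"
    by (auto simp: m_def A_def)
  have "0 < m" using w0 adjD by metis
  show ?thesis
  proof (cases "t \<le> m")
    case True
    have le_t: "t \<le> elen w x" if "adj w x" for w
      using True le_m[OF that] by simp
    obtain f where "admissible D f"
      "\<And>w. adj w x \<Longrightarrow> 1 \<le> Poly_Mapping.lookup D (ep w x t) + div_of G f (ep w x t)"
      using move_chips_towards[OF eff chips t(1) le_t] by blast
    with a show ?thesis unfolding reaches_def by blast
  next
    case False
    obtain f where f: "admissible D f"
      "\<And>w. adj w x \<Longrightarrow> 1 \<le> Poly_Mapping.lookup D (ep w x m) + div_of G f (ep w x m)"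
      using move_chips_towards[OF eff chips \<open>0 < m\<close> le_m] by blast
    note rat = admissible_rational[OF f(1)]
    have 1: "1 \<le> Poly_Mapping.lookup (plus_div D f) (ep w x m)"
      using f(2)[OF a] by (simp add: lookup_plus_div[OF rat])
    have 2: "1 \<le> Poly_Mapping.lookup (plus_div D f) (ep w x (elen w x))"
      using f(2)[OF w0(1)] ep_end[OF w0(1)] ep_end[OF a] w0(2) by (simp add: lookup_plus_div[OF rat])
    have "reaches (plus_div D f) (ep w x t)"
      using admissible_effective[OF f(1)] a less_imp_le[OF \<open>0 < m\<close>] _ t(2) order_refl 1 2
      by (rule reaches_between) (use False in auto)
    then show ?thesis by (rule reaches_plus_div[OF f(1)])
  qed
qed

lemma ex_divisor_of_independent_set:
  assumes S: "S \<subseteq> verts G" "edges G \<inter> [S]\<^bsup>2\<^esup> = {}"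
    and nbr: "\<And>x. x \<in> S \<Longrightarrow> \<exists>w. adj w x"
  shows "\<exists>D. divisor_on G D \<and> div_degree D = int (card (verts G)) - int (card S) \<and> has_pos_rank D"
proof -
  define P where "P = vertex_point ` (verts G - S)"
  define D where "D = Abs_poly_mapping (\<lambda>p. if p \<in> P then 1 else 0 :: int)"
  have finP: "finite P" using finite_verts by (simp add: P_def)
  then have D: "Poly_Mapping.lookup D p = (if p \<in> P then 1 else 0)" for p
    unfolding D_def by simp
  have keys: "Poly_Mapping.keys D = P" by (auto simp: in_keys_iff D split: if_splits)
  have on: "divisor_on G D" unfolding divisor_on_def keys P_def using vertex_in_points by blast
  have "div_degree D = int (card P)"
    unfolding div_degree_def keys by (simp add: D)
  also have "card P = card (verts G - S)"
    unfolding P_def by (intro card_image) (simp add: inj_on_def)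
  finally have deg: "div_degree D = int (card (verts G)) - int (card S)"
    using S(1) finite_verts by (simp add: card_Diff_subset finite_subset card_mono of_nat_diff)
  have eff: "effective D" by (simp add: effective_def D)
  have chip: "1 \<le> Poly_Mapping.lookup D (vertex_point w)" if "w \<in> verts G" "w \<notin> S" for w
    using that by (simp add: D P_def)
  have indep: "w \<notin> S" if "adj w x" "x \<in> S" for w x
  proof
    assume "w \<in> S"
    then have "{w, x} \<in> [S]\<^bsup>2\<^esup>" using that adjD[OF that(1)] by (simp add: nsets_def)
    with S(2) that show False by blast
  qed
  have into: "reaches D (ep w x t)" if "adj w x" "x \<in> S" "0 < t" "t \<le> elen w x" for w x t
    using eff _ that(1,3,4) by (rule reaches_into_vertex) (use indep that(2) chip adjD in blast)
  have "has_pos_rank D"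
  proof (rule has_pos_rankI[OF on])
    fix p assume "p \<in> points G"
    then show "reaches D p"
    proof (cases rule: point_cases)
      case (vertex w)
      show ?thesis
      proof (cases "w \<in> S")
        case True
        then obtain y where y: "adj y w" using nbr by blast
        with into[OF y True, of "elen y w"] adjD[OF y] show ?thesis
          by (simp add: vertex ep_end[OF y])
      next
        case False
        with vertex chip reaches_chip[OF eff] show ?thesis by blast
      qed
    next
      case (interior u v t)
      note a = interior(1)
      consider "v \<in> S" | "u \<in> S" | "u \<notin> S" "v \<notin> S" by blast
      then show ?thesis
      proof cases
        case 1
        with into[OF a] interior show ?thesis by simp
      next
        case 2
        have "p = ep v u (elen v u - t)" using ep_reverse[of v u t] interior adjD[OF a] by simp
        with into[of v u "elen v u - t"] 2 interior adjD[OF a] show ?thesis by simp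
      next
        case 3
        have "reaches D (ep u v t)"
          using eff a order_refl
          by (rule reaches_between[where b = "elen u v"])
            (use interior 3 chip adjD[OF a] ep_start[OF a] ep_end[OF a] in auto)
        with interior show ?thesis by simp
      qed
    qed
  qed
  with on deg show ?thesis by blast
qed

section \<open>Gonality\<close>

text \<open>The condition in the definition of the rank fails for numbers exceeding the degree, so the greatest
  number satisfying it exists and satisfies it.\<close>

lemma has_pos_rank_if_div_rank_1:
  assumes "divisor_on G D" "div_rank G D = 1" "verts G \<noteq> {}"
  shows "has_pos_rank D"
proof -
  define P where "P r \<longleftrightarrow> (\<forall>E. divisor_on G E \<and> effective E \<and> div_degree E = int r \<longrightarrow>
                 linear_system G (D - E) \<noteq> {})" for r
  have "linear_system G D \<noteq> {}" "(GREATEST r. P r) = 1"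
    using assms(2) unfolding div_rank_def P_def by (auto split: if_splits)
  then have "P 0" unfolding P_def using effective_degree_0 by fastforce
  obtain v where v: "v \<in> verts G" using assms(3) by blast
  have bound: "r \<le> nat (div_degree D)" if "P r" for r
  proof -
    let ?E = "Poly_Mapping.single (vertex_point v) (int r)"
    have "linear_system G (D - ?E) \<noteq> {}"
      using that vertex_in_points[OF v] unfolding P_def
      by (simp add: divisor_on_single effective_single div_degree_single)
    then obtain H where H: "effective H" "lin_equiv G H (D - ?E)"
      unfolding linear_system_def by blast
    from lin_equiv_degree[OF H(2)] div_degree_nonneg[OF H(1)] show ?thesis
      by (simp add: div_degree_diff div_degree_single)
  qed
  have "P (GREATEST r. P r)" using \<open>P 0\<close> bound by (rule GreatestI_nat[where P = P])
  then have "P 1" by (simp add: \<open>(GREATEST r. P r) = 1\<close>)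
  then show ?thesis
    unfolding has_pos_rank_def P_def
    by (simp add: divisor_on_single effective_single div_degree_single)
qed

text \<open>If \<open>r \<ge> 2\<close> satisfied the condition in the definition of the rank, subtracting \<open>r - 1\<close> times a
  vertex would give a divisor of positive rank and smaller degree.\<close>

lemma div_rank_1_if_min_degree:
  assumes D: "divisor_on G D" "has_pos_rank D" and "verts G \<noteq> {}"
    and min: "\<And>D'. divisor_on G D' \<Longrightarrow> has_pos_rank D' \<Longrightarrow> div_degree D \<le> div_degree D'"
  shows "div_rank G D = 1"
proof -
  define P where "P r \<longleftrightarrow> (\<forall>E. divisor_on G E \<and> effective E \<and> div_degree E = int r \<longrightarrow>
                 linear_system G (D - E) \<noteq> {})" for r
  obtain v where v: "vertex_point v \<in> points G" using assms(3) vertex_in_points by blast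
  obtain E where "effective E" "divisor_on G E" "lin_equiv G E D"
    using has_pos_rankD[OF D(2,1) v] by blast
  then have ne: "linear_system G D \<noteq> {}" unfolding linear_system_def by blast
  have "(GREATEST r. P r) = 1"
  proof (rule Greatest_equality)
    show "P 1"
      unfolding P_def
    proof (intro allI impI, elim conjE)
      fix E assume E: "divisor_on G E" "effective E" "div_degree E = int 1"
      then obtain p where "p \<in> Poly_Mapping.keys E" "E = Poly_Mapping.single p 1"
        using effective_degree_1[of E] by auto
      with E(1) D(2) show "linear_system G (D - E) \<noteq> {}"
        unfolding has_pos_rank_def divisor_on_def by blast
    qed
  next
    fix r assume r: "P r"
    show "r \<le> 1"
    proof (rule ccontr)
      assume "\<not> r \<le> 1"
      define H where "H = Poly_Mapping.single (vertex_point v) (int r - 1)"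
      have H: "divisor_on G H" "effective H" "div_degree H = int r - 1"
        using \<open>\<not> r \<le> 1\<close> v by (auto simp: H_def divisor_on_single effective_single div_degree_single)
      have "has_pos_rank (D - H)"
        unfolding has_pos_rank_def
      proof
        fix p assume "p \<in> points G"
        then have "divisor_on G (H + Poly_Mapping.single p 1)" "effective (H + Poly_Mapping.single p 1)"
          "div_degree (H + Poly_Mapping.single p 1) = int r"
          using H by (auto simp: divisor_on_add divisor_on_single effective_add effective_single
              div_degree_add div_degree_single)
        then have "linear_system G (D - (H + Poly_Mapping.single p 1)) \<noteq> {}"
          using r unfolding P_def by blast
        then show "linear_system G (D - H - Poly_Mapping.single p 1) \<noteq> {}"
          by (simp add: diff_diff_eq)
      qed
      from min[OF divisor_on_diff[OF D(1) H(1)] this] H(3) \<open>\<not> r \<le> 1\<close>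
      show False by (simp add: div_degree_diff)
    qed
  qed
  with ne show ?thesis unfolding div_rank_def P_def by simp
qed

lemma gonality_eqI:
  assumes "verts G \<noteq> {}" "divisor_on G D" "has_pos_rank D" "div_degree D = n"
    and "\<And>D. divisor_on G D \<Longrightarrow> has_pos_rank D \<Longrightarrow> n \<le> div_degree D"
  shows "gonality G = n"
  unfolding gonality_def
proof (rule Least_equality)
  show "\<exists>D. divisor_on G D \<and> div_degree D = n \<and> div_rank G D = 1"
    using assms by (intro exI[of _ D] conjI div_rank_1_if_min_degree) auto
next
  fix k assume "\<exists>D. divisor_on G D \<and> div_degree D = k \<and> div_rank G D = 1"
  then show "n \<le> k" using has_pos_rank_if_div_rank_1 assms(1,5) by blast
qed

end

lemma contains_K_antimono:
  assumes "contains_K V F k" "j \<le> k"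
  shows "contains_K V F j"
proof -
  obtain S where S: "S \<subseteq> V" "card S = k" "[S]\<^bsup>2\<^esup> \<subseteq> F" using assms(1) unfolding contains_K_def by blast
  obtain T where "T \<subseteq> S" "card T = j" using obtain_subset_with_card_n[of j S] assms(2) S(2) by blast
  with S nsets_mono[of T S 2] show ?thesis unfolding contains_K_def by blast
qed

theorem theorem21:
  fixes V :: "'a set" and l :: "'a set \<Rightarrow> real" and F :: "'a set set" and d i h :: nat
  assumes "d \<ge> 3" and "1 \<le> i" and "i \<le> d - 2"
    and "finite V" and "card V = d"
    and "\<And>e. e \<in> [V]\<^bsup>2\<^esup> \<Longrightarrow> 0 < l e"
    and "F \<subseteq> [V]\<^bsup>2\<^esup>" and "card F = i"
    and "h \<ge> 1"
  shows "gonality (omit_edges (complete_wgraph V l) F) = int d - int h \<longleftrightarrow>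
    contains_K V F h \<and> \<not> contains_K V F (h + 1)"
proof -
  define G where "G = omit_edges (complete_wgraph V l) F"
  have G: "verts G = V" "edges G = [V]\<^bsup>2\<^esup> - F" "len G = l"
    by (simp_all add: G_def omit_edges_def complete_wgraph_def)
  interpret metric_graph G
    by unfold_locales (use assms in \<open>auto simp: G\<close>)
  have le_d: "k \<le> d" if "contains_K V F k" for k
    using that assms(4,5) unfolding contains_K_def by (auto intro: card_mono)
  have "contains_K V F 0" by (auto simp: contains_K_def nsets_def intro: exI[of _ "{}"])
  define \<omega> where "\<omega> = (GREATEST k. contains_K V F k)"
  have \<omega>: "contains_K V F \<omega>" unfolding \<omega>_def
    using \<open>contains_K V F 0\<close> le_d by (rule GreatestI_nat[where P = "contains_K V F"])
  have le_\<omega>: "k \<le> \<omega>" if "contains_K V F k" for k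
    unfolding \<omega>_def using that le_d by (rule Greatest_le_nat[where P = "contains_K V F"])
  have contains_iff: "contains_K V F k \<longleftrightarrow> k \<le> \<omega>" for k
    using le_\<omega> contains_K_antimono[OF \<omega>] by blast
  have "2 \<le> \<omega>"
  proof -
    obtain e where e: "e \<in> F" using assms(2,8) by fastforce
    with assms(7) have "e \<subseteq> V" "card e = 2" by (auto simp: nsets_def)
    moreover from this(2) have "[e]\<^bsup>2\<^esup> = {e}" by (auto simp: card_2_iff)
    ultimately show ?thesis using e by (intro le_\<omega>) (auto simp: contains_K_def)
  qed
  obtain S where S: "S \<subseteq> V" "card S = \<omega>" "[S]\<^bsup>2\<^esup> \<subseteq> F" using \<omega> unfolding contains_K_def by blast
  have nbr: "\<exists>w. adj w x" if x: "x \<in> V" for x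
  proof (rule ccontr)
    assume neg: "\<nexists>w. adj w x"
    have "(\<lambda>w. {w, x}) ` (V - {x}) \<subseteq> F"
      using neg x by (auto simp: G nsets_def card_insert_if split: if_splits)
    then have "card ((\<lambda>w. {w, x}) ` (V - {x})) \<le> card F"
      using assms(2,8) by (intro card_mono) (auto intro: card_ge_0_finite)
    moreover have "card ((\<lambda>w. {w, x}) ` (V - {x})) = card (V - {x})"
      by (rule card_image) (auto simp: inj_on_def doubleton_eq_iff)
    ultimately show False using x assms(1-5,8) by simp
  qed
  obtain D where D: "divisor_on G D" "div_degree D = int d - int \<omega>" "has_pos_rank D"
    using ex_divisor_of_independent_set[of S] S nbr assms(5) unfolding G by blast
  have "gonality G = int d - int \<omega>"
  proof (rule gonality_eqI[OF _ D(1,3,2)])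
    show "verts G \<noteq> {}" using assms(1,5) by (auto simp: G)
    fix D' assume D': "divisor_on G D'" "has_pos_rank D'"
    show "int d - int \<omega> \<le> div_degree D'"
    proof (cases "div_degree D' < int d - 2")
      case True
      have "[V]\<^bsup>2\<^esup> - edges G = F" using assms(7) by (auto simp: G)
      then obtain T where T: "T \<subseteq> V" "edges G \<inter> [T]\<^bsup>2\<^esup> = {}" "int d - div_degree D' \<le> int (card T)"
        using independent_set_of_low_degree[OF _ _ D'] True assms(1,3,5,8) unfolding G(1) by auto
      have "[T]\<^bsup>2\<^esup> \<subseteq> F" using T(2) nsets_mono[OF T(1), of 2] by (auto simp: G)
      then have "card T \<le> \<omega>" using T(1) by (intro le_\<omega>) (auto simp: contains_K_def)
      with T(3) show ?thesis by simp
    next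
      case False
      with \<open>2 \<le> \<omega>\<close> show ?thesis by simp
    qed
  qed
  then show ?thesis
    unfolding G_def[symmetric] contains_iff by auto
qed

end
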